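(* Let $n\in\mathbb{N}$ and $\alpha>0$. (a) Let $1\le r\le p\le\infty$ and $0<T<\infty$. If $n<2\alpha$, then for all $f\in L^r(\mathbb{R}^n)$, $$\int_0^T s^{-\frac{nr}{2p\alpha}}\|e^{-s(-\Delta)^{\alpha}}f\|_{L^p(\mathbb{R}^n)}^r\,ds\lesssim T^{1-\frac{n}{2\alpha}}\|f\|_{L^r(\mathbb{R}^n)}^r.$$ (b) Let $2<p\le\infty$. If $n=2\alpha$, then for all $f\in L^2(\mathbb{R}^n)$, $$\int_0^\infty s^{-2/p}\|e^{-s(-\Delta)^{\alpha}}f\|_{L^p(\mathbb{R}^n)}^2\,ds\lesssim \|f\|_{L^2(\mathbb{R}^n)}^2.$$
   Context: For $s\ge 0$, $e^{-s(-\Delta)^{\alpha}}f=\mathcal{F}^{-1}\big(e^{-s|\xi|^{2\alpha}}\mathcal{F}f(\xi)\big)$, where $\mathcal{F}$ is the Fourier transform on $\mathbb{R}^n$. $A\lesssim B$ means $A\le CB$ for a positive constant $C$ independent of $f$ (and of $T$). *)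

theory Defs
  imports "HOL-Analysis.Analysis" "HOL-Probability.Essential_Supremum"
begin

text \<open>Real powers of extended nonnegative reals (exponent assumed positive): infinity stays infinity.\<close>
definition enn_powr :: "ennreal \<Rightarrow> real \<Rightarrow> ennreal" where
  "enn_powr x a = (if x = top then top else ennreal (enn2real x powr a))"

definition Lp_norm :: "ereal \<Rightarrow> (real^'n \<Rightarrow> complex) \<Rightarrow> ennreal" where
  "Lp_norm p f =
     (if p = \<infinity> then esssup lborel (\<lambda>x. ennreal (norm (f x)))
      else enn_powr (\<integral>\<^sup>+ x. ennreal (norm (f x) powr real_of_ereal p) \<partial>lborel)
                    (1 / real_of_ereal p))"

definition in_Lp :: "ereal \<Rightarrow> (real^'n \<Rightarrow> complex) \<Rightarrow> bool" where
  "in_Lp p f \<longleftrightarrow> f \<in> borel_measurable lborel \<and> Lp_norm p f < top"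

text \<open>Kernel of e^{-s(-Delta)^alpha}: inverse Fourier transform of the multiplier
  xi |-> exp(-s |xi|^(2 alpha)), with F f(xi) = int f(x) e^{-i x.xi} dx and
  F^{-1} g(x) = (2 pi)^{-n} int g(xi) e^{i x.xi} dxi.\<close>
definition frac_heat_kernel :: "real \<Rightarrow> real \<Rightarrow> real^'n \<Rightarrow> complex" where
  "frac_heat_kernel \<alpha> s x =
     (1 / (2 * pi) ^ CARD('n)) *\<^sub>R
     (\<integral> \<xi>. cis (x \<bullet> \<xi>) * complex_of_real (exp (- s * norm \<xi> powr (2 * \<alpha>))) \<partial>lborel)"

text \<open>The semigroup e^{-s(-Delta)^alpha} f: identity for s = 0, and for s > 0 the Fourier
  multiplier by exp(-s|xi|^(2 alpha)), realised (as on all L^r) as convolution with the kernel.\<close>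
definition frac_heat :: "real \<Rightarrow> real \<Rightarrow> (real^'n \<Rightarrow> complex) \<Rightarrow> (real^'n \<Rightarrow> complex)" where
  "frac_heat \<alpha> s f =
     (if s = 0 then f
      else (\<lambda>x. \<integral> y. frac_heat_kernel \<alpha> s (x - y) * f y \<partial>lborel))"

end

theory Submission
  imports Defs
begin

text \<open>Write \<open>\<nu> = n / (2\<alpha>)\<close>. In both parts \<open>2\<alpha> \<ge> 1\<close>, which makes the kernel \<open>K\<^sub>s\<close> of the semigroup
  satisfy \<open>\<bar>K\<^sub>s\<bar> \<le> B s\<^bsup>-\<nu>\<^esup>\<close> and \<open>\<integral>\<bar>K\<^sub>s\<bar> \<le> B\<close>: by scaling it suffices that \<open>K\<^sub>1\<close> is
  \<open>O(\<bar>x\<bar>\<^bsup>-n-1/2\<^esup>)\<close>. For this, replace the symbol \<open>g\<close> by its \<open>(n+1)\<close>-fold difference with step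
  \<open>h = \<pi>x/\<bar>x\<bar>\<^sup>2\<close>, which costs only a factor \<open>(-2)\<^bsup>n+1\<^esup>\<close>; it is \<open>O(\<bar>h\<bar>\<^bsup>1/2\<^esup>)\<close> near the origin,
  since \<open>\<bar>g - 1\<bar> \<le> \<bar>\<xi>\<bar>\<^bsup>1/2\<^esup>\<close>, and \<open>O(\<bar>h\<bar>\<^bsup>n+1\<^esup>\<bar>\<xi>\<bar>\<^bsup>-n-1/2\<^esup>)\<close> away from it. Jensen's inequality turns
  the kernel bounds into \<open>\<parallel>K\<^sub>s * f\<parallel>\<^sub>p \<le> B s\<^bsup>-\<nu>(1/r-1/p)\<^esup> \<parallel>f\<parallel>\<^sub>r\<close> for \<open>r \<le> p\<close>.

  Part (a) is the integral of \<open>s\<^bsup>-\<nu>\<^esup>\<close>. In part (b), where \<open>\<nu> = 1\<close>, the sublinear map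
  \<open>f \<mapsto> s\<^bsup>-1/p\<^esup>\<parallel>K\<^sub>s * f\<parallel>\<^sub>p\<close> is bounded by \<open>s\<^bsup>-1/r\<^esup>\<parallel>f\<parallel>\<^sub>r\<close>, hence of weak type \<open>(r,r)\<close>, for every finite
  \<open>r\<close> between \<open>1\<close> and \<open>p\<close>, and Marcinkiewicz interpolation gives the strong type \<open>(2,2)\<close>.\<close>

section \<open>Integrals over Euclidean space\<close>

lemma nn_integral_lborel_scaleR:
  fixes F :: "'a::euclidean_space \<Rightarrow> ennreal"
  assumes [measurable]: "F \<in> borel_measurable borel" and c: "0 < c"
  shows "(\<integral>\<^sup>+x. F (c *\<^sub>R x) \<partial>lborel) = ennreal (1 / c ^ DIM('a)) * (\<integral>\<^sup>+x. F x \<partial>lborel)"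
proof -
  have "(\<integral>\<^sup>+x. F x \<partial>lborel) = ennreal (c ^ DIM('a)) * (\<integral>\<^sup>+x. F (c *\<^sub>R x) \<partial>lborel)"
    using c by (subst lborel_affine[of c 0]) (simp_all add: nn_integral_density nn_integral_distr nn_integral_cmult)
  then have "ennreal (1 / c ^ DIM('a)) * (\<integral>\<^sup>+x. F x \<partial>lborel)
      = (ennreal (1 / c ^ DIM('a)) * ennreal (c ^ DIM('a))) * (\<integral>\<^sup>+x. F (c *\<^sub>R x) \<partial>lborel)"
    by (simp add: mult.assoc)
  also have "ennreal (1 / c ^ DIM('a)) * ennreal (c ^ DIM('a)) = 1"
    using c by (simp flip: ennreal_mult)
  finally show ?thesis by simp
qed

lemma integral_lborel_scaleR:
  fixes F :: "'a::euclidean_space \<Rightarrow> 'b::{banach, second_countable_topology}"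
  assumes [measurable]: "F \<in> borel_measurable borel" and c: "0 < c"
  shows "(\<integral>x. F (c *\<^sub>R x) \<partial>lborel) = (1 / c ^ DIM('a)) *\<^sub>R (\<integral>x. F x \<partial>lborel)"
proof -
  have "(\<integral>x. F x \<partial>lborel) = (c ^ DIM('a)) *\<^sub>R (\<integral>x. F (c *\<^sub>R x) \<partial>lborel)"
    using c by (subst lborel_affine[of c 0]) (simp_all add: integral_density integral_distr)
  then show ?thesis using c by simp
qed

lemma nn_integral_lborel_minus_left:
  fixes F :: "'a::euclidean_space \<Rightarrow> ennreal"
  assumes [measurable]: "F \<in> borel_measurable borel"
  shows "(\<integral>\<^sup>+y. F (x - y) \<partial>lborel) = (\<integral>\<^sup>+y. F y \<partial>lborel)"
proof -
  have "(\<integral>\<^sup>+y. F y \<partial>lborel) = (\<integral>\<^sup>+y. F (x + (-1) *\<^sub>R y) \<partial>lborel)"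
    by (subst lborel_affine[of "-1" x]) (simp_all add: nn_integral_density nn_integral_distr nn_integral_cmult)
  then show ?thesis by simp
qed

lemma nn_integral_lborel_minus_right:
  fixes F :: "'a::euclidean_space \<Rightarrow> ennreal"
  assumes [measurable]: "F \<in> borel_measurable borel"
  shows "(\<integral>\<^sup>+x. F (x - y) \<partial>lborel) = (\<integral>\<^sup>+x. F x \<partial>lborel)"
  by (subst (2) lborel_distr_plus[of "- y", symmetric]) (simp add: nn_integral_distr)

lemma
  fixes F :: "'a::euclidean_space \<Rightarrow> 'b::{banach, second_countable_topology}"
  assumes [measurable]: "F \<in> borel_measurable borel"
  shows integral_lborel_translate: "(\<integral>x. F (x + h) \<partial>lborel) = (\<integral>x. F x \<partial>lborel)"
    and integrable_lborel_translate: "integrable lborel (\<lambda>x. F (x + h)) \<longleftrightarrow> integrable lborel F"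
   by (subst (2) lborel_distr_plus[of h, symmetric], simp add: integral_distr integrable_distr_eq add.commute)+

lemma nn_integral_powr_atLeast:
  fixes e :: real
  assumes "e < - 1" "0 < a"
  shows "(\<integral>\<^sup>+x. ennreal (x powr e) * indicator {a..} x \<partial>lborel) = ennreal (a powr (e + 1) / (- e - 1))"
proof -
  have "((\<lambda>x. x powr e) has_integral - (a powr (e + 1)) / (e + 1)) {a..}"
    by (rule has_integral_powr_to_inf) (use assms in auto)
  also have "- (a powr (e + 1)) / (e + 1) = a powr (e + 1) / (- e - 1)"
    using assms by (simp add: divide_simps) (simp add: algebra_simps)
  finally have "((\<lambda>x. x powr e) has_integral a powr (e + 1) / (- e - 1)) {a..}" .
  from nn_integral_has_integral_lebesgue[OF _ this]
  have "integral\<^sup>N lborel (\<lambda>x. indicator {a..} x * x powr e) = a powr (e + 1) / (- e - 1)"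
    by (simp)
  then show ?thesis
    by (subst (asm) nn_integral_cong[where v="\<lambda>x. ennreal (x powr e) * indicator {a..} x"])
       (auto split: split_indicator)
qed

lemma nn_integral_powr_greaterThanLessThan:
  fixes e :: real
  assumes "- 1 < e" "0 \<le> c"
  shows "(\<integral>\<^sup>+x. ennreal (x powr e) * indicator {0<..<c} x \<partial>lborel) = ennreal (c powr (e + 1) / (e + 1))"
proof -
  have "((\<lambda>x. x powr e) has_integral c powr (e + 1) / (e + 1)) {0..c}"
    by (rule has_integral_powr_from_0) (use assms in auto)
  from nn_integral_has_integral_lebesgue[OF _ this]
  have "integral\<^sup>N lborel (\<lambda>x. indicator {0..c} x * x powr e) = c powr (e + 1) / (e + 1)"
    by simp
  moreover have "(\<integral>\<^sup>+x. ennreal (x powr e) * indicator {0<..<c} x \<partial>lborel)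
      = integral\<^sup>N lborel (\<lambda>x. indicator {0..c} x * x powr e)"
    by (rule nn_integral_cong_AE, rule AE_mp[OF AE_lborel_singleton[of 0] AE_mp[OF AE_lborel_singleton[of c]]])
       (auto split: split_indicator)
  ultimately show ?thesis by simp
qed

text \<open>A layer-cake argument replaces polar coordinates: \<open>(1 + norm x) powr (- q)\<close>
  is the integral of \<open>q * r powr (- q - 1)\<close> over \<open>r >= 1 + norm x\<close>. After
  exchanging the integrals only volumes of balls enter, and \<open>r powr (d - q - 1)\<close> with
  \<open>d = DIM('a)\<close> is integrable at infinity because \<open>q > d\<close>.\<close>

lemma nn_integral_one_plus_norm_powr_finite:
  fixes q :: real
  assumes q: "real DIM('a::euclidean_space) < q"
  shows "(\<integral>\<^sup>+x. ennreal ((1 + norm (x::'a)) powr (- q)) \<partial>lborel) < \<infinity>"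
proof -
  let ?d = "real DIM('a)"
  have q0: "q > 0" using q by simp
  have layer: "ennreal ((1 + norm x) powr (- q))
      = (\<integral>\<^sup>+r. ennreal (q * r powr (- q - 1)) * indicator {1 + norm (x::'a)..} r \<partial>lborel)" for x :: 'a
  proof -
    have "(\<integral>\<^sup>+r. ennreal (q * r powr (- q - 1)) * indicator {1 + norm (x::'a)..} r \<partial>lborel)
        = ennreal q * (\<integral>\<^sup>+r. ennreal (r powr (- q - 1)) * indicator {1 + norm (x::'a)..} r \<partial>lborel)"
      using q0 by (subst nn_integral_cmult[symmetric]) (auto simp: ennreal_mult mult.assoc)
    also have "\<dots> = ennreal q * ennreal ((1 + norm x) powr (- q) / q)"
      by (subst nn_integral_powr_atLeast) (use q0 in \<open>auto simp: add_pos_nonneg\<close>)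
    also have "\<dots> = ennreal ((1 + norm x) powr (- q))"
      using q0 by (simp flip: ennreal_mult)
    finally show ?thesis by simp
  qed
  have "(\<integral>\<^sup>+x. ennreal ((1 + norm (x::'a)) powr (- q)) \<partial>lborel)
      = (\<integral>\<^sup>+x. (\<integral>\<^sup>+r. ennreal (q * r powr (- q - 1)) * indicator {1 + norm (x::'a)..} r \<partial>lborel) \<partial>lborel)"
    by (simp add: layer)
  also have "\<dots> = (\<integral>\<^sup>+r. (\<integral>\<^sup>+x. ennreal (q * r powr (- q - 1)) * indicator {1 + norm (x::'a)..} r \<partial>lborel) \<partial>lborel)"
    unfolding indicator_def atLeast_iff by (rule lborel_pair.Fubini') measurable
  also have "\<dots> \<le> (\<integral>\<^sup>+r. ennreal (q * unit_ball_vol ?d) * (ennreal (r powr (?d - q - 1)) * indicator {1..} r) \<partial>lborel)"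
  proof (rule nn_integral_mono)
    fix r :: real
    \<comment> \<open>The set of \<open>x\<close> with \<open>1 + norm x <= r\<close> is empty for
      \<open>r < 1\<close>, which the factor \<open>indicator {1..} r\<close> records, and otherwise
      lies in the ball of radius \<open>r\<close>.\<close>
    have "(\<integral>\<^sup>+x. ennreal (q * r powr (- q - 1)) * indicator {1 + norm (x::'a)..} r \<partial>lborel)
      \<le> (\<integral>\<^sup>+x. ennreal (q * r powr (- q - 1)) * indicator {1..} r * indicator (cball (0::'a) r) x \<partial>lborel)"
      by (rule nn_integral_mono) (auto split: split_indicator intro: order_trans[of _ "1 + norm _"])
    also have "\<dots> = ennreal (q * r powr (- q - 1)) * indicator {1..} r * emeasure lborel (cball (0::'a) r)"
      by (subst nn_integral_cmult) (auto intro!: borel_measurable_indicator)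
    also have "\<dots> = ennreal (q * unit_ball_vol ?d) * (ennreal (r powr (?d - q - 1)) * indicator {1..} r)"
    proof (cases "r \<ge> 1")
      case True
      then have "r powr (?d - q - 1) = r powr (- q - 1) * r ^ DIM('a)"
        by (simp flip: powr_realpow powr_add add: algebra_simps)
      then show ?thesis
        using True q0 by (simp add: emeasure_cball mult_ac flip: ennreal_mult)
    qed simp
    finally show "(\<integral>\<^sup>+x. ennreal (q * r powr (- q - 1)) * indicator {1 + norm (x::'a)..} r \<partial>lborel) \<le> \<dots>" .
  qed
  also have "\<dots> = ennreal (q * unit_ball_vol ?d) * ennreal (1 / (q - ?d))"
    by (subst nn_integral_cmult, simp, subst nn_integral_powr_atLeast) (use q in auto)
  also have "\<dots> < \<infinity>" by (simp add: ennreal_mult_less_top)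
  finally show ?thesis .
qed

section \<open>Finite differences and derivatives of the symbol\<close>

text \<open>The innermost difference is taken first, so an induction on the order with
  \<open>g\<close> arbitrary passes directly to the function
  \<open>x |-> g (x + h) - g x\<close>.\<close>

primrec fdiff :: "nat \<Rightarrow> 'a::real_vector \<Rightarrow> ('a \<Rightarrow> real) \<Rightarrow> 'a \<Rightarrow> real" where
  "fdiff 0 h g = g"
| "fdiff (Suc m) h g = fdiff m h (\<lambda>x. g (x + h) - g x)"

text \<open>Only the sample points \<open>x + i h\<close> with \<open>i <= m\<close> enter, and each
  difference at most doubles the bound.\<close>

lemma abs_fdiff_le:
  assumes "\<And>i. i \<le> m \<Longrightarrow> \<bar>g (x + real i *\<^sub>R h)\<bar> \<le> B"
  shows "\<bar>fdiff m h g x\<bar> \<le> 2 ^ m * B"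
  using assms
proof (induction m arbitrary: g B)
  case (Suc m)
  have "\<bar>g (x + real i *\<^sub>R h + h) - g (x + real i *\<^sub>R h)\<bar> \<le> 2 * B" if "i \<le> m" for i
    using Suc.prems[of i] Suc.prems[of "Suc i"] that by (simp add: algebra_simps)
  then have "\<bar>fdiff m h (\<lambda>x. g (x + h) - g x) x\<bar> \<le> 2 ^ m * (2 * B)"
    by (intro Suc.IH) auto
  then show ?case by simp
qed (use assms[of 0] in simp)

text \<open>Allows the symbol \<open>g\<close> to be replaced by \<open>g - 1\<close>, which is
  small near the origin.\<close>

lemma fdiff_diff_const: "fdiff (Suc m) h (\<lambda>x. g x - c) = fdiff (Suc m) h g"
  by simp

text \<open>Reduces differences on the space to differences in one real variable, where the mean
  value theorem applies.\<close>

lemma fdiff_along_line: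
  "fdiff m (h *\<^sub>R e) g (x + t *\<^sub>R e) = fdiff m h (\<lambda>t. g (x + t *\<^sub>R e)) t"
  by (induction m arbitrary: g) (simp_all add: algebra_simps)

text \<open>One use of the mean value theorem per difference, with \<open>F k\<close> in the role of
  the \<open>k\<close>-th derivative of \<open>F 0\<close>. The hypotheses concern only the segment
  from \<open>t\<close> to \<open>t + m h\<close>: the symbol need not be smooth at the origin, and
  the segment will be kept away from it.\<close>

lemma abs_fdiff_le_derivative:
  fixes F :: "nat \<Rightarrow> real \<Rightarrow> real"
  assumes "0 < h"
    and "\<And>k s. k < m \<Longrightarrow> t \<le> s \<Longrightarrow> s \<le> t + m * h \<Longrightarrow> (F k has_real_derivative F (Suc k) s) (at s)"
    and "\<And>s. t \<le> s \<Longrightarrow> s \<le> t + m * h \<Longrightarrow> \<bar>F m s\<bar> \<le> B"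
  shows "\<bar>fdiff m h (F 0) t\<bar> \<le> h ^ m * B"
  using assms
proof (induction m arbitrary: F B)
  case (Suc m)
  \<comment> \<open>\<open>G k\<close> is the \<open>k\<close>-th derivative of the first difference
    of \<open>F 0\<close>. The induction hypothesis is applied to \<open>G\<close> on a segment
    shorter by \<open>h\<close>, with the bound \<open>h * B\<close>.\<close>
  define G where "G = (\<lambda>k s. F k (s + h) - F k s)"
  have "(G k has_real_derivative G (Suc k) s) (at s)" if "k < m" "t \<le> s" "s \<le> t + m * h" for k s
  proof -
    have "t + m * h \<le> t + Suc m * h" using \<open>0 < h\<close> by simp
    then have "(F k has_real_derivative F (Suc k) s) (at s)"
      "(F k has_real_derivative F (Suc k) (s + h)) (at (s + h))"
      using that \<open>0 < h\<close> by (auto intro!: Suc.prems simp: algebra_simps)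
    then show ?thesis
      unfolding G_def DERIV_shift by (rule DERIV_diff[rotated])
  qed
  moreover have "\<bar>G m s\<bar> \<le> h * B" if "t \<le> s" "s \<le> t + m * h" for s
  proof -
    have "\<exists>z. s < z \<and> z < s + h \<and> F m (s + h) - F m s = (s + h - s) * F (Suc m) z"
      by (rule MVT2) (use that \<open>0 < h\<close> in \<open>auto intro!: Suc.prems simp: algebra_simps\<close>)
    then obtain z where z: "s < z" "z < s + h" "F m (s + h) - F m s = h * F (Suc m) z" by auto
    have "\<bar>F (Suc m) z\<bar> \<le> B"
      by (rule Suc.prems) (use z that \<open>0 < h\<close> in \<open>auto simp: algebra_simps\<close>)
    then show ?thesis using z \<open>0 < h\<close> by (simp add: G_def abs_mult mult_left_mono)
  qed
  ultimately have "\<bar>fdiff m h (G 0) t\<bar> \<le> h ^ m * (h * B)"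
    using \<open>0 < h\<close> by (intro Suc.IH) auto
  then show ?case by (simp add: G_def mult_ac)
qed (use assms in simp)

lemma integrable_cis_inner_mult:
  fixes g :: "'a::euclidean_space \<Rightarrow> real"
  assumes "integrable lborel g"
  shows "integrable lborel (\<lambda>\<xi>. cis (x \<bullet> \<xi>) * complex_of_real (g \<xi>))"
proof -
  have [measurable]: "(\<lambda>\<xi>. cis (x \<bullet> \<xi>)) \<in> borel_measurable borel"
    by (intro borel_measurable_continuous_onI continuous_intros)
  have [measurable]: "g \<in> borel_measurable borel" using assms by (auto dest: borel_measurable_integrable)
  show ?thesis
    by (rule Bochner_Integration.integrable_bound[OF assms]) (auto simp: norm_mult)
qed

text \<open>A shift by \<open>h\<close> with \<open>x \<bullet> h = \<pi>\<close> changes the sign of the oscillating factor, so every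
  difference contributes a factor \<open>-2\<close>: smoothness of \<open>g\<close> becomes decay of its transform.\<close>
lemma integral_cis_fdiff:
  fixes g :: "'a::euclidean_space \<Rightarrow> real"
  assumes "integrable lborel g" and h: "x \<bullet> h = pi"
  shows "integrable lborel (fdiff m h g)
    \<and> (\<integral>\<xi>. cis (x \<bullet> \<xi>) * complex_of_real (fdiff m h g \<xi>) \<partial>lborel)
      = (- 2) ^ m * (\<integral>\<xi>. cis (x \<bullet> \<xi>) * complex_of_real (g \<xi>) \<partial>lborel)"
  using assms(1)
proof (induction m arbitrary: g)
  case (Suc m)
  let ?I = "\<lambda>g. \<integral>\<xi>. cis (x \<bullet> \<xi>) * complex_of_real (g \<xi>) \<partial>lborel"
  have [measurable]: "g \<in> borel_measurable borel" using Suc.prems by (auto dest: borel_measurable_integrable)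
  have [measurable]: "(\<lambda>\<xi>. cis (x \<bullet> \<xi>)) \<in> borel_measurable borel"
    by (intro borel_measurable_continuous_onI continuous_intros)
  have sh: "integrable lborel (\<lambda>\<xi>. g (\<xi> + h))"
    using Suc.prems by (simp add: integrable_lborel_translate)
  have "?I g = (\<integral>\<xi>. cis (x \<bullet> (\<xi> + h)) * complex_of_real (g (\<xi> + h)) \<partial>lborel)"
    by (rule integral_lborel_translate[symmetric]) measurable
  also have "\<dots> = (\<integral>\<xi>. - (cis (x \<bullet> \<xi>) * complex_of_real (g (\<xi> + h))) \<partial>lborel)"
    by (simp add: inner_add_right h flip: cis_mult)
  finally have "?I (\<lambda>\<xi>. g (\<xi> + h)) = - ?I g" by simp
  then have "?I (\<lambda>\<xi>. g (\<xi> + h) - g \<xi>) = - 2 * ?I g"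
    using integrable_cis_inner_mult[OF sh, of x] integrable_cis_inner_mult[OF Suc.prems, of x]
    by (simp add: right_diff_distrib)
  with Suc.IH[of "\<lambda>\<xi>. g (\<xi> + h) - g \<xi>"] sh Suc.prems show ?case by simp
qed simp

section \<open>Pointwise bounds for the derivatives of the symbol along a line\<close>

lemma power_le_fact_mult_exp:
  fixes x :: real
  assumes "0 \<le> x"
  shows "x ^ m \<le> fact m * exp x"
proof -
  have "(\<Sum>k\<in>{m}. x ^ k /\<^sub>R fact k) \<le> (\<Sum>k. x ^ k /\<^sub>R fact k)"
    by (rule sum_le_suminf) (use assms summable_exp_generic[of x] in auto)
  then show ?thesis by (simp add: exp_def field_simps)
qed

lemma powr_mult_exp_minus_le:
  fixes \<beta> :: real
  assumes "0 \<le> \<beta>"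
  obtains C where "0 < C" "\<And>w. 0 \<le> w \<Longrightarrow> w powr \<beta> * exp (- w) \<le> C"
proof
  \<comment> \<open>Rounding the exponent up lets a single term of the exponential series dominate
    \<open>w powr \<beta>\<close> for \<open>w > 1\<close>; for \<open>w <= 1\<close> the bound 1
    suffices.\<close>
  define m where "m = nat \<lceil>\<beta>\<rceil>"
  show "0 < 1 + (fact m :: real)" by (simp add: add_pos_pos)
  fix w :: real assume w: "0 \<le> w"
  have m: "\<beta> \<le> real m" unfolding m_def by linarith
  have "w powr \<beta> \<le> 1 + w ^ m"
  proof (cases "w \<le> 1")
    case True
    then have "w powr \<beta> \<le> 1" using w assms by (cases "w = 0") (auto intro: powr_le1)
    then show ?thesis using w by (simp add: add_increasing2)
  next
    case False
    then have "w powr \<beta> \<le> w powr real m" using m by (intro powr_mono) auto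
    then show ?thesis using False by (simp add: powr_realpow)
  qed
  also have "\<dots> \<le> exp w + fact m * exp w"
    using power_le_fact_mult_exp[OF w, of m] w by (intro add_mono) auto
  finally show "w powr \<beta> * exp (- w) \<le> 1 + fact m"
    by (simp add: exp_minus field_simps)
qed

text \<open>The \<open>k\<close>-th \<open>t\<close>-derivative of \<open>exp (- ((a + t\<^sup>2) powr \<alpha>))\<close> is a sum of such terms; the condition
  \<open>i + k = 2 * l\<close> says that without the factor \<open>(a + t\<^sup>2) powr (j * \<alpha>)\<close> and the exponential they
  are homogeneous of degree \<open>- k\<close> in \<open>(sqrt a, t)\<close>.\<close>
inductive heat_deriv :: "real \<Rightarrow> nat \<Rightarrow> (real \<Rightarrow> real \<Rightarrow> real) \<Rightarrow> bool" for \<alpha> k where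
  monomial: "1 \<le> j \<Longrightarrow> i + k = 2 * l \<Longrightarrow>
    heat_deriv \<alpha> k (\<lambda>a t. c * t ^ i * (a + t\<^sup>2) powr (real j * \<alpha> - real l) * exp (- ((a + t\<^sup>2) powr \<alpha>)))"
| sum: "heat_deriv \<alpha> k F \<Longrightarrow> heat_deriv \<alpha> k G \<Longrightarrow> heat_deriv \<alpha> k (\<lambda>a t. F a t + G a t)"

text \<open>The product rule turns a monomial with parameters \<open>(i, l, j)\<close> into
  monomials with \<open>(i - 1, l, j)\<close>, \<open>(i + 1, l + 1, j)\<close> and
  \<open>(i + 1, l + 1, j + 1)\<close>, according to which factor is differentiated. Each preserves
  the parity condition with \<open>k\<close> replaced by \<open>k + 1\<close>.\<close>

lemma heat_deriv_derivative:
  assumes "heat_deriv \<alpha> k F"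
  shows "\<exists>F'. heat_deriv \<alpha> (Suc k) F'
    \<and> (\<forall>a t. 0 < a + t\<^sup>2 \<longrightarrow> (F a has_real_derivative F' a t) (at t))"
  using assms
proof induction
  case (monomial j i l c)
  let ?E = "\<lambda>a t::real. exp (- ((a + t\<^sup>2) powr \<alpha>))"
  let ?D1 = "\<lambda>a t. (c * real i) * t ^ (i - 1) * (a + t\<^sup>2) powr (real j * \<alpha> - real l) * ?E a t"
  let ?D2 = "\<lambda>a t. (c * 2 * (real j * \<alpha> - real l)) * t ^ (i + 1) * (a + t\<^sup>2) powr (real j * \<alpha> - real (l + 1)) * ?E a t"
  let ?D3 = "\<lambda>a t. (- c * 2 * \<alpha>) * t ^ (i + 1) * (a + t\<^sup>2) powr (real (j + 1) * \<alpha> - real (l + 1)) * ?E a t"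
  have 2: "heat_deriv \<alpha> (Suc k) ?D2" "heat_deriv \<alpha> (Suc k) ?D3"
    by (rule heat_deriv.monomial; use monomial in simp)+
  have 1: "heat_deriv \<alpha> (Suc k) ?D1"
  proof (cases "i = 0")
    case True
    \<comment> \<open>For \<open>i = 0\<close> the truncated \<open>i - 1\<close> would break the
      parity condition. The term has coefficient 0, so any admissible monomial with coefficient 0
      can stand for it.\<close>
    have "heat_deriv \<alpha> (Suc k) (\<lambda>a t. 0 * t ^ (i + 1) * (a + t\<^sup>2) powr (real j * \<alpha> - real (l + 1)) * ?E a t)"
      using monomial by (intro heat_deriv.monomial) auto
    then show ?thesis using True by simp
  next
    case False
    then show ?thesis using monomial by (intro heat_deriv.monomial) auto
  qed
  show ?case
  proof (intro exI conjI allI impI)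
    show "heat_deriv \<alpha> (Suc k) (\<lambda>a t. ?D1 a t + (?D2 a t + ?D3 a t))"
      using 1 2 by (intro heat_deriv.sum)
    fix a t :: real assume pos: "0 < a + t\<^sup>2"
    have p: "(a + t\<^sup>2) powr (real j * \<alpha> - real l - 1) = (a + t\<^sup>2) powr (real j * \<alpha> - real (l + 1))"
      by (simp add: algebra_simps)
    have q: "(a + t\<^sup>2) powr (real (j + 1) * \<alpha> - real (l + 1))
        = (a + t\<^sup>2) powr (real j * \<alpha> - real l) * (a + t\<^sup>2) powr (\<alpha> - 1)"
      by (simp add: algebra_simps flip: powr_add)
    show "((\<lambda>t. c * t ^ i * (a + t\<^sup>2) powr (real j * \<alpha> - real l) * ?E a t)
        has_real_derivative ?D1 a t + (?D2 a t + ?D3 a t)) (at t)"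
    proof -
      let ?w = "a + t\<^sup>2" and ?\<beta> = "real j * \<alpha> - real l"
      have w: "((\<lambda>t. a + t\<^sup>2) has_real_derivative 2 * t) (at t)"
        by (auto intro!: derivative_eq_intros)
      have P: "((\<lambda>t. (a + t\<^sup>2) powr \<beta>) has_real_derivative \<beta> * ?w powr (\<beta> - 1) * (2 * t)) (at t)" for \<beta>
        using DERIV_fun_powr[OF w pos, of \<beta>] by simp
      have E: "(?E a has_real_derivative ?E a t * - (\<alpha> * ?w powr (\<alpha> - 1) * (2 * t))) (at t)"
        by (intro DERIV_fun_exp DERIV_minus P)
      have "((\<lambda>t. c * t ^ i) has_real_derivative c * (real i * t ^ (i - 1))) (at t)"
        by (auto intro!: derivative_eq_intros)
      from DERIV_mult[OF DERIV_mult[OF this P[of ?\<beta>]] E]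
      show ?thesis
        by (rule DERIV_cong) (simp only: q p, simp add: algebra_simps)
    qed
  qed
next
  case (sum F G)
  then obtain F' G' where "heat_deriv \<alpha> (Suc k) F'" "heat_deriv \<alpha> (Suc k) G'"
    "\<forall>a t. 0 < a + t\<^sup>2 \<longrightarrow> (F a has_real_derivative F' a t) (at t)"
    "\<forall>a t. 0 < a + t\<^sup>2 \<longrightarrow> (G a has_real_derivative G' a t) (at t)" by blast
  then show ?case
    by (intro exI[of _ "\<lambda>a t. F' a t + G' a t"]) (auto intro!: heat_deriv.sum derivative_intros)
qed

text \<open>Put \<open>w = a + t^2\<close>. Since \<open>|t| ^ i <= w powr (i / 2)\<close> and
  \<open>i + k = 2 * l\<close>, a monomial is at most a multiple of
  \<open>w powr (j * \<alpha> - k / 2) * exp (- (w powr \<alpha>))\<close>. Splitting off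
  \<open>w powr (1 / 4 - k / 2)\<close> leaves a bounded factor, because
  \<open>j * \<alpha> >= 1 / 4\<close>. For \<open>w = |\<xi>|^2\<close> and
  \<open>k = n + 1\<close> the resulting decay is \<open>|\<xi>| powr (- n - 1/2)\<close>, just
  enough for integrability at infinity.\<close>

lemma heat_deriv_bound:
  assumes "heat_deriv \<alpha> k F" "1 / 4 \<le> \<alpha>"
  shows "\<exists>C>0. \<forall>a t. 0 \<le> a \<longrightarrow> 0 < a + t\<^sup>2 \<longrightarrow> \<bar>F a t\<bar> \<le> C * (a + t\<^sup>2) powr (1 / 4 - real k / 2)"
  using assms(1)
proof induction
  case (monomial j i l c)
  \<comment> \<open>In the variable \<open>v = w powr \<alpha>\<close> the factor
    \<open>w powr (j * \<alpha> - 1 / 4)\<close> is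
    \<open>v powr (j - 1 / (4 * \<alpha>))\<close>.\<close>
  have "0 \<le> real j - 1 / (4 * \<alpha>)"
  proof -
    have "1 / (4 * \<alpha>) \<le> 1" using assms(2) by (simp add: field_simps)
    also have "1 \<le> real j" using monomial by simp
    finally show ?thesis by simp
  qed
  then obtain C where C: "0 < C" "\<And>w. 0 \<le> w \<Longrightarrow> w powr (real j - 1 / (4 * \<alpha>)) * exp (- w) \<le> C"
    using powr_mult_exp_minus_le by blast
  show ?case
  proof (intro exI conjI allI impI)
    show "0 < (\<bar>c\<bar> + 1) * C" using C by simp
    fix a t :: real assume a: "0 \<le> a" and pos: "0 < a + t\<^sup>2"
    let ?w = "a + t\<^sup>2"
    have t: "\<bar>t\<bar> ^ i \<le> ?w powr (real i / 2)"
    proof (cases "t = 0")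
      case True
      then show ?thesis using pos by (cases i) auto
    next
      case False
      then have "\<bar>t\<bar> ^ i = (\<bar>t\<bar> powr 2) powr (real i / 2)"
        by (simp only: powr_powr) (simp add: powr_realpow)
      also have "\<dots> \<le> ?w powr (real i / 2)" using a by (intro powr_mono2) auto
      finally show ?thesis .
    qed
    have "\<bar>c * t ^ i * ?w powr (real j * \<alpha> - real l) * exp (- (?w powr \<alpha>))\<bar>
        \<le> (\<bar>c\<bar> + 1) * ?w powr (real i / 2) * ?w powr (real j * \<alpha> - real l) * exp (- (?w powr \<alpha>))"
      unfolding abs_mult power_abs abs_exp_cancel by (intro mult_mono t mult_nonneg_nonneg) auto
    also have "\<dots> = (\<bar>c\<bar> + 1) * ((?w powr \<alpha>) powr (real j - 1 / (4 * \<alpha>)) * exp (- (?w powr \<alpha>))) * ?w powr (1 / 4 - real k / 2)"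
    proof -
      have e: "\<alpha> * (real j - 1 / (4 * \<alpha>)) = real j * \<alpha> - 1 / 4"
        using assms(2) by (simp add: field_simps)
      have "real i + real k = 2 * real l" using monomial by linarith
      then have "?w powr (real i / 2) * ?w powr (real j * \<alpha> - real l) = (?w powr \<alpha>) powr (real j - 1 / (4 * \<alpha>)) * ?w powr (1 / 4 - real k / 2)"
        unfolding powr_powr powr_add[symmetric] e
        by (intro arg_cong[where f="(powr) _"]) (simp add: field_simps)
      then show ?thesis by (simp add: mult_ac)
    qed
    also have "\<dots> \<le> (\<bar>c\<bar> + 1) * C * ?w powr (1 / 4 - real k / 2)"
      by (intro mult_right_mono mult_left_mono C) auto
    finally show "\<bar>c * t ^ i * ?w powr (real j * \<alpha> - real l) * exp (- (?w powr \<alpha>))\<bar>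
        \<le> (\<bar>c\<bar> + 1) * C * ?w powr (1 / 4 - real k / 2)" .
  qed
next
  case (sum F G)
  then obtain C D where "C > 0" "D > 0"
    "\<forall>a t. 0 \<le> a \<longrightarrow> 0 < a + t\<^sup>2 \<longrightarrow> \<bar>F a t\<bar> \<le> C * (a + t\<^sup>2) powr (1 / 4 - real k / 2)"
    "\<forall>a t. 0 \<le> a \<longrightarrow> 0 < a + t\<^sup>2 \<longrightarrow> \<bar>G a t\<bar> \<le> D * (a + t\<^sup>2) powr (1 / 4 - real k / 2)" by blast
  then show ?case
    by (intro exI[of _ "C + D"]) (auto simp: ring_distribs intro!: order_trans[OF abs_triangle_ineq] add_mono)
qed

text \<open>The symbol itself would be a monomial with \<open>j = 0\<close> and does not vanish at
  the origin, so the bound fails for \<open>k = 0\<close>. The sequence is therefore chosen from the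
  first derivative on, and the symbol is put in front of it.\<close>

lemma heat_symbol_derivatives:
  assumes "1 / 4 \<le> \<alpha>"
  obtains D :: "nat \<Rightarrow> real \<Rightarrow> real \<Rightarrow> real" where
    "\<And>a t. D 0 a t = exp (- ((a + t\<^sup>2) powr \<alpha>))"
    "\<And>k a t. 0 < a + t\<^sup>2 \<Longrightarrow> (D k a has_real_derivative D (Suc k) a t) (at t)"
    "\<And>k. 1 \<le> k \<Longrightarrow> \<exists>C>0. \<forall>a t. 0 \<le> a \<longrightarrow> 0 < a + t\<^sup>2 \<longrightarrow> \<bar>D k a t\<bar> \<le> C * (a + t\<^sup>2) powr (1 / 4 - real k / 2)"
proof -
  let ?g = "\<lambda>a t. exp (- ((a + t\<^sup>2) powr \<alpha>))"
  let ?g' = "\<lambda>a t. (- 2 * \<alpha>) * t ^ 1 * (a + t\<^sup>2) powr (real 1 * \<alpha> - real 1) * exp (- ((a + t\<^sup>2) powr \<alpha>))"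
  have "\<exists>D. heat_deriv \<alpha> (Suc 0) (D 0) \<and> D 0 = ?g' \<and> (\<forall>k. heat_deriv \<alpha> (Suc k) (D k) \<and>
      (\<forall>a t. 0 < a + t\<^sup>2 \<longrightarrow> (D k a has_real_derivative D (Suc k) a t) (at t)))"
  proof -
    have "heat_deriv \<alpha> (Suc 0) ?g'" by (rule heat_deriv.monomial) auto
    then have "\<exists>D. \<forall>k. (heat_deriv \<alpha> (Suc k) (D k) \<and> (k = 0 \<longrightarrow> D k = ?g')) \<and>
      (\<forall>a t. 0 < a + t\<^sup>2 \<longrightarrow> (D k a has_real_derivative D (Suc k) a t) (at t))"
      by (intro dependent_nat_choice) (blast, metis heat_deriv_derivative nat.distinct(1))
    then show ?thesis by blast
  qed
  then obtain D where D: "D 0 = ?g'" "\<And>k. heat_deriv \<alpha> (Suc k) (D k)"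
    "\<And>k a t. 0 < a + t\<^sup>2 \<Longrightarrow> (D k a has_real_derivative D (Suc k) a t) (at t)" by blast
  have g': "(?g a has_real_derivative ?g' a t) (at t)" if "0 < a + t\<^sup>2" for a t
    by (rule derivative_eq_intros refl that)+ (use that in \<open>simp add: powr_diff\<close>)
  show ?thesis
  proof
    let ?D = "case_nat ?g D"
    show "?D 0 a t = ?g a t" for a t by simp
    show "(?D k a has_real_derivative ?D (Suc k) a t) (at t)" if "0 < a + t\<^sup>2" for k a t
      using D(3)[OF that] g'[OF that] by (cases k) (auto simp: D(1))
    show "\<exists>C>0. \<forall>a t. 0 \<le> a \<longrightarrow> 0 < a + t\<^sup>2 \<longrightarrow> \<bar>?D k a t\<bar> \<le> C * (a + t\<^sup>2) powr (1 / 4 - real k / 2)"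
      if "1 \<le> k" for k
      using that heat_deriv_bound[OF D(2) assms] by (cases k) auto
  qed
qed

section \<open>Bounds for the kernel\<close>

text \<open>There are two regimes, with \<open>m = n + 1\<close> differences. If
  \<open>|\<xi>| < 2 m |h|\<close>, all sample points are within \<open>3 m |h|\<close> of the
  origin and the smallness of \<open>g - 1\<close> is used. Otherwise the whole segment of samples
  stays at distance at least \<open>|\<xi>| / 2\<close> from the origin and the derivative bound of
  order \<open>m\<close> applies. Writing the weight in terms of \<open>|\<xi>| / |h|\<close> makes
  its integral an exact multiple of \<open>|h| ^ n\<close>.\<close>

lemma fdiff_heat_symbol_bound:
  assumes \<alpha>: "1 / 4 \<le> \<alpha>"
  defines "n \<equiv> DIM('a::euclidean_space)"
  obtains C where "0 < C"
    "\<And>(\<xi>::'a) h. h \<noteq> 0 \<Longrightarrow> \<bar>fdiff (Suc n) h (\<lambda>\<xi>. exp (- (norm \<xi> powr (2 * \<alpha>)))) \<xi>\<bar>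
      \<le> C * norm h powr (1 / 2) * (1 + norm \<xi> / norm h) powr (- (real n + 1 / 2))"
proof -
  let ?g = "\<lambda>\<xi>::'a. exp (- (norm \<xi> powr (2 * \<alpha>)))"
  define m where "m = Suc n"
  define q where "q = real n + 1 / 2"
  have mq: "1 / 4 - real m / 2 = - q / 2" "q > 0" "m \<ge> 1" "real m = q + 1 / 2"
    by (auto simp: m_def q_def field_simps)
  obtain D where D: "\<And>a t. D 0 a t = exp (- ((a + t\<^sup>2) powr \<alpha>))"
    "\<And>k a t. 0 < a + t\<^sup>2 \<Longrightarrow> (D k a has_real_derivative D (Suc k) a t) (at t)"
    "\<And>k. 1 \<le> k \<Longrightarrow> \<exists>C>0. \<forall>a t. 0 \<le> a \<longrightarrow> 0 < a + t\<^sup>2 \<longrightarrow> \<bar>D k a t\<bar> \<le> C * (a + t\<^sup>2) powr (1 / 4 - real k / 2)"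
    using heat_symbol_derivatives[OF \<alpha>] by blast
  obtain C0 where C0: "C0 > 0" "\<And>a t. 0 \<le> a \<Longrightarrow> 0 < a + t\<^sup>2 \<Longrightarrow> \<bar>D m a t\<bar> \<le> C0 * (a + t\<^sup>2) powr (- q / 2)"
    using D(3)[OF \<open>m \<ge> 1\<close>] unfolding mq(1) by metis
  \<comment> \<open>Constant of the near regime: \<open>2 ^ m\<close> from the differences,
    \<open>(3 m) powr (1 / 2)\<close> from the size of the sample points, and the last factor to
    insert \<open>w powr (- q)\<close>, since there \<open>w <= 1 + 2 m\<close>.\<close>
  define C1 where "C1 = 2 ^ m * (3 * real m) powr (1 / 2) * (1 + 2 * real m) powr q"
  have C1: "C1 \<ge> 0" by (simp add: C1_def)
  show ?thesis
  proof
    show "0 < C1 + C0 * 4 powr q" using C0 C1 by (simp add: add_nonneg_pos)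
    fix \<xi> h :: 'a assume h: "h \<noteq> 0"
    define \<eta> where "\<eta> = norm h"
    define w where "w = 1 + norm \<xi> / \<eta>"
    have \<eta>: "\<eta> > 0" using h by (simp add: \<eta>_def)
    have w: "w \<ge> 1" using \<eta> by (simp add: w_def)
    have "\<bar>fdiff m h ?g \<xi>\<bar> \<le> (C1 + C0 * 4 powr q) * \<eta> powr (1 / 2) * w powr (- q)"
    proof (cases "norm \<xi> < 2 * real m * \<eta>")
      case True
      have "\<bar>?g (\<xi> + real i *\<^sub>R h) - 1\<bar> \<le> (3 * real m * \<eta>) powr (1 / 2)" if "i \<le> m" for i
      proof -
        let ?z = "\<xi> + real i *\<^sub>R h"
        have "norm ?z \<le> norm \<xi> + real i * \<eta>"
          using norm_triangle_ineq[of \<xi> "real i *\<^sub>R h"] by (simp add: \<eta>_def)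
        also have "real i * \<eta> \<le> real m * \<eta>" using that \<eta> by (intro mult_right_mono) auto
        finally have z: "norm ?z \<le> 3 * real m * \<eta>" using True by simp
        \<comment> \<open>For \<open>|z| <= 1\<close> this is \<open>1 - exp (- u) <= u\<close>
          together with \<open>2 * \<alpha> >= 1 / 2\<close>; for \<open>|z| > 1\<close> it holds
          because the symbol takes values in the unit interval.\<close>
        have "\<bar>?g ?z - 1\<bar> \<le> norm ?z powr (1 / 2)"
        proof (cases "norm ?z \<le> 1")
          case True
          have "1 - norm ?z powr (2 * \<alpha>) \<le> ?g ?z" using exp_ge_add_one_self[of "- (norm ?z powr (2 * \<alpha>))"] by simp
          moreover have "?g ?z \<le> 1" by simp
          moreover have "norm ?z powr (2 * \<alpha>) \<le> norm ?z powr (1 / 2)"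
            using True \<alpha> by (intro powr_mono') auto
          ultimately show ?thesis by linarith
        next
          case False
          have "?g ?z \<le> 1" "0 \<le> ?g ?z" by simp_all
          moreover have "1 \<le> norm ?z powr (1 / 2)" using False by (intro ge_one_powr_ge_zero) auto
          ultimately show ?thesis by linarith
        qed
        also have "\<dots> \<le> (3 * real m * \<eta>) powr (1 / 2)" using z by (intro powr_mono2) auto
        finally show ?thesis .
      qed
      then have "\<bar>fdiff m h (\<lambda>z. ?g z - 1) \<xi>\<bar> \<le> 2 ^ m * (3 * real m * \<eta>) powr (1 / 2)"
        by (intro abs_fdiff_le) auto
      also have "\<dots> = 2 ^ m * (3 * real m) powr (1 / 2) * \<eta> powr (1 / 2) * 1"
        using \<eta> by (simp add: powr_mult)
      also have "\<dots> \<le> 2 ^ m * (3 * real m) powr (1 / 2) * \<eta> powr (1 / 2) * ((1 + 2 * real m) powr q * w powr (- q))"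
      proof (intro mult_left_mono)
        have "w \<le> 1 + 2 * real m" using True \<eta> by (simp add: w_def field_simps)
        then have "w powr q \<le> (1 + 2 * real m) powr q" using w mq by (intro powr_mono2) auto
        then show "1 \<le> (1 + 2 * real m) powr q * w powr (- q)"
          using w by (simp add: powr_minus field_simps)
      qed auto
      also have "\<dots> = C1 * \<eta> powr (1 / 2) * w powr (- q)" by (simp add: C1_def mult_ac)
      also have "\<dots> \<le> (C1 + C0 * 4 powr q) * \<eta> powr (1 / 2) * w powr (- q)"
        using C0 by (intro mult_right_mono) auto
      finally show ?thesis unfolding m_def fdiff_diff_const .
    next
      case False
      \<comment> \<open>Restriction to the line through \<xi> in the direction of \<open>h\<close>:
        \<open>a\<close> is the squared distance of this line from the origin and \<open>- b\<close>
        the parameter of the nearest point, so the squared norm becomes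
        \<open>a + (t + b)^2\<close>.\<close>
      define e where "e = h /\<^sub>R \<eta>"
      have e: "norm e = 1" "h = \<eta> *\<^sub>R e" using \<eta> by (auto simp: e_def \<eta>_def)
      then have ee: "e \<bullet> e = 1" by (simp add: dot_square_norm)
      define b where "b = \<xi> \<bullet> e"
      define a where "a = (norm \<xi>)\<^sup>2 - b\<^sup>2"
      have line: "(norm (\<xi> + t *\<^sub>R e))\<^sup>2 = a + (t + b)\<^sup>2" for t
        unfolding power2_norm_eq_inner a_def b_def
        by (simp add: inner_add_left inner_add_right ee inner_commute power2_eq_square algebra_simps)
      have "\<bar>b\<bar> \<le> norm \<xi>" using Cauchy_Schwarz_ineq2[of \<xi> e] e by (simp add: b_def)
      then have a: "a \<ge> 0" unfolding a_def using power_mono[of "\<bar>b\<bar>" "norm \<xi>" 2] by simp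
      have gD: "(\<lambda>t. ?g (\<xi> + t *\<^sub>R e)) = (\<lambda>t. D 0 a (t + b))"
      proof
        fix t
        have "norm (\<xi> + t *\<^sub>R e) powr (2 * \<alpha>) = ((norm (\<xi> + t *\<^sub>R e)) powr 2) powr \<alpha>"
          by (simp only: powr_powr)
        also have "\<dots> = (a + (t + b)\<^sup>2) powr \<alpha>" by (simp flip: line)
        finally show "?g (\<xi> + t *\<^sub>R e) = D 0 a (t + b)" by (simp only: D)
      qed
      \<comment> \<open>Moving by at most \<open>m \<eta> <= |\<xi>| / 2\<close> loses at most half
        of the norm.\<close>
      have far: "norm \<xi> / 2 \<le> norm (\<xi> + s *\<^sub>R e)" if "0 \<le> s" "s \<le> 0 + real m * \<eta>" for s
      proof -
        have "norm \<xi> \<le> norm (\<xi> + s *\<^sub>R e) + s"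
          using norm_triangle_ineq4[of "\<xi> + s *\<^sub>R e" "s *\<^sub>R e"] that e by simp
        then show ?thesis using that False by simp
      qed
      have "\<eta> \<le> real m * \<eta>" using mq(3) \<eta> by simp
      then have \<xi>: "norm \<xi> \<ge> 2 * \<eta>" using False by linarith
      then have \<xi>0: "norm \<xi> > 0" using \<eta> by linarith
      have far2: "(norm \<xi> / 2)\<^sup>2 \<le> a + (s + b)\<^sup>2" "0 < a + (s + b)\<^sup>2"
        if "0 \<le> s" "s \<le> 0 + real m * \<eta>" for s
      proof -
        show 1: "(norm \<xi> / 2)\<^sup>2 \<le> a + (s + b)\<^sup>2"
          unfolding line[symmetric] by (intro power_mono far that) auto
        have "0 < (norm \<xi> / 2)\<^sup>2" using \<xi>0 by simp
        with 1 show "0 < a + (s + b)\<^sup>2" by linarith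
      qed
      have "\<bar>fdiff m \<eta> (\<lambda>t. D 0 a (t + b)) 0\<bar> \<le> \<eta> ^ m * (C0 * (norm \<xi> / 2) powr (- q))"
      proof (rule abs_fdiff_le_derivative[where F="\<lambda>k t. D k a (t + b)"])
        show "((\<lambda>t. D k a (t + b)) has_real_derivative D (Suc k) a (s + b)) (at s)"
          if "0 \<le> s" "s \<le> 0 + real m * \<eta>" for k s
          using D(2)[OF far2(2)[OF that], of k] by (simp add: DERIV_shift)
        show "\<bar>D m a (s + b)\<bar> \<le> C0 * (norm \<xi> / 2) powr (- q)"
          if "0 \<le> s" "s \<le> 0 + real m * \<eta>" for s
        proof -
          have "\<bar>D m a (s + b)\<bar> \<le> C0 * (a + (s + b)\<^sup>2) powr (- q / 2)"
            by (rule C0(2)[OF a far2(2)[OF that]])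
          also have "(a + (s + b)\<^sup>2) powr (- q / 2) \<le> ((norm \<xi> / 2)\<^sup>2) powr (- q / 2)"
            using \<xi>0 mq far2(1)[OF that] by (intro powr_mono2') auto
          also have "((norm \<xi> / 2)\<^sup>2) powr (- q / 2) = ((norm \<xi> / 2) powr 2) powr (- q / 2)"
            using \<xi>0 by simp
          also have "\<dots> = (norm \<xi> / 2) powr (- q)" by (simp only: powr_powr) simp
          finally show ?thesis using C0 by simp
        qed
      qed (use \<eta> in auto)
      also have "fdiff m \<eta> (\<lambda>t. D 0 a (t + b)) 0 = fdiff m h ?g \<xi>"
        using fdiff_along_line[of m \<eta> e ?g \<xi> 0] unfolding gD e(2)[symmetric] by simp
      \<comment> \<open>From \<open>|\<xi>| >= 2 \<eta>\<close> one gets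
        \<open>\<eta> w = \<eta> + |\<xi>| <= 2 |\<xi>|\<close>, which brings the bound into the
        scale invariant variable \<open>w\<close>; the powers of \<eta> then combine to
        \<open>m - q = 1 / 2\<close>.\<close>
      also have "\<eta> ^ m * (C0 * (norm \<xi> / 2) powr (- q)) \<le> \<eta> ^ m * (C0 * (\<eta> * w / 4) powr (- q))"
      proof (intro mult_left_mono powr_mono2')
        show "0 < \<eta> * w / 4" using \<eta> w by simp
        show "\<eta> * w / 4 \<le> norm \<xi> / 2" using \<eta> \<xi> by (simp add: w_def field_simps)
      qed (use \<eta> C0(1) mq(2) in auto)
      also have "(\<eta> * w / 4) powr (- q) = \<eta> powr (- q) * w powr (- q) * 4 powr q"
        using \<eta> w by (simp add: powr_mult powr_divide powr_minus field_simps)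
      also have "\<eta> ^ m * (C0 * (\<eta> powr (- q) * w powr (- q) * 4 powr q))
          = C0 * 4 powr q * (\<eta> ^ m * \<eta> powr (- q)) * w powr (- q)" by (simp add: mult_ac)
      also have "\<eta> ^ m * \<eta> powr (- q) = \<eta> powr (1 / 2)"
        using \<eta> mq by (simp flip: powr_realpow powr_add)
      also have "C0 * 4 powr q * \<eta> powr (1 / 2) * w powr (- q) \<le> (C1 + C0 * 4 powr q) * \<eta> powr (1 / 2) * w powr (- q)"
        using C1 by (intro mult_right_mono) auto
      finally show ?thesis .
    qed
    then show "\<bar>fdiff (Suc n) h ?g \<xi>\<bar> \<le> (C1 + C0 * 4 powr q) * norm h powr (1 / 2)
        * (1 + norm \<xi> / norm h) powr (- (real n + 1 / 2))"
      by (simp add: m_def q_def w_def \<eta>_def)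
  qed
qed

text \<open>This is the kernel at time 1 without the factor \<open>(2 * pi) ^ n\<close> in the
  denominator, on an arbitrary Euclidean space.\<close>

definition heat_transform :: "real \<Rightarrow> 'a::euclidean_space \<Rightarrow> complex" where
  "heat_transform \<alpha> x = (\<integral>\<xi>. cis (x \<bullet> \<xi>) * complex_of_real (exp (- (norm \<xi> powr (2 * \<alpha>)))) \<partial>lborel)"

lemma borel_measurable_cis [measurable]: "cis \<in> borel_measurable borel"
  by (intro borel_measurable_continuous_onI continuous_intros)

lemma borel_measurable_heat_transform [measurable]: "heat_transform \<alpha> \<in> borel_measurable borel"
  unfolding heat_transform_def by measurable

text \<open>Merges a trivial bound near 0 and a decay bound at infinity into one weight; the factor
  comes from \<open>1 + t <= 2 * max 1 t\<close>.\<close>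

lemma min_one_powr_le:
  assumes "0 \<le> q" "0 \<le> (t::real)"
  shows "min 1 (t powr (- q)) \<le> 2 powr q * (1 + t) powr (- q)"
proof (cases "t \<le> 1")
  case True
  have "(1 + t) powr q \<le> 2 powr q" using True assms by (intro powr_mono2) auto
  then have "1 \<le> 2 powr q * (1 + t) powr (- q)" using assms by (simp add: powr_minus field_simps add_pos_nonneg)
  then show ?thesis by simp
next
  case False
  have "t powr (- q) \<le> ((1 + t) / 2) powr (- q)" using False assms by (intro powr_mono2') auto
  also have "\<dots> = 2 powr q * (1 + t) powr (- q)"
    using assms by (simp add: powr_divide powr_minus field_simps)
  finally show ?thesis by simp
qed

lemma integrable_heat_symbol:
  assumes "1 / 4 \<le> \<alpha>"
  shows "integrable lborel (\<lambda>\<xi>::'a::euclidean_space. exp (- (norm \<xi> powr (2 * \<alpha>))))"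
proof -
  define q where "q = real DIM('a) + 1"
  have q0: "0 \<le> q" by (simp add: q_def)
  then have "0 \<le> q / (2 * \<alpha>)" using assms by simp
  then obtain C where C: "C > 0" "\<And>w. 0 \<le> w \<Longrightarrow> w powr (q / (2 * \<alpha>)) * exp (- w) \<le> C"
    using powr_mult_exp_minus_le by blast
  have bd: "exp (- (t powr (2 * \<alpha>))) \<le> (C + 1) * 2 powr q * (1 + t) powr (- q)" if t: "0 \<le> t" for t
  proof -
    let ?E = "exp (- (t powr (2 * \<alpha>)))"
    have "t powr q * ?E \<le> C"
      using C(2)[of "t powr (2 * \<alpha>)"] assms by (simp add: powr_powr)
    then have "t > 0 \<Longrightarrow> ?E \<le> C * t powr (- q)" by (simp add: powr_minus field_simps)
    moreover have "C * t powr (- q) \<le> (C + 1) * t powr (- q)" by (simp add: mult_right_mono)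
    moreover have "?E \<le> 1" by simp
    ultimately have "?E \<le> (C + 1) * min 1 (t powr (- q))" if "t > 0"
    proof -
      assume *: "t > 0 \<Longrightarrow> ?E \<le> C * t powr (- q)" "C * t powr (- q) \<le> (C + 1) * t powr (- q)" "?E \<le> 1"
      have "?E \<le> (C + 1) * t powr (- q)" using * that by linarith
      moreover have "?E \<le> (C + 1) * 1" 
        by (rule order_trans[OF *(3)]) (use C(1) in simp)
      ultimately show ?thesis unfolding min_def by presburger
    qed
    moreover have "?E \<le> (C + 1) * (2 powr q * (1 + t) powr (- q))" if "t = 0"
      using that C q0 by (simp add: mult_ge1_I ge_one_powr_ge_zero)
    moreover have "(C + 1) * min 1 (t powr (- q)) \<le> (C + 1) * (2 powr q * (1 + t) powr (- q))"
      using C(1) by (intro mult_left_mono min_one_powr_le[OF q0 t]) auto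
    ultimately show ?thesis
      using t unfolding mult.assoc by (metis less_eq_real_def order_trans)
  qed
  have fin: "(\<integral>\<^sup>+x. ennreal ((1 + norm (x::'a)) powr (- q)) \<partial>lborel) < \<infinity>"
    by (rule nn_integral_one_plus_norm_powr_finite) (simp add: q_def)
  have "(\<integral>\<^sup>+\<xi>. ennreal (norm (exp (- (norm (\<xi>::'a) powr (2 * \<alpha>))))) \<partial>lborel)
      \<le> (\<integral>\<^sup>+\<xi>. ennreal ((C + 1) * 2 powr q) * ennreal ((1 + norm (\<xi>::'a)) powr (- q)) \<partial>lborel)"
    using bd C(1) by (intro nn_integral_mono) (simp add: ennreal_mult[symmetric])
  also have "\<dots> < \<infinity>"
    using fin by (subst nn_integral_cmult) (auto simp: ennreal_mult_less_top)
  finally show ?thesis by (intro integrableI_bounded) auto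
qed

text \<open>The step \<open>h = (pi / |x|^2) x\<close> satisfies \<open>x \<bullet> h = pi\<close>
  and has length \<open>\<eta> = pi / |x|\<close>. Integrating the difference bound gives
  \<open>\<eta> ^ n\<close> from rescaling the weight and another
  \<open>\<eta> powr (1 / 2)\<close>, hence decay of order \<open>n + 1/2\<close>. Near the origin
  the integral \<open>G\<close> of the symbol is used instead.\<close>

lemma heat_transform_decay:
  assumes \<alpha>: "1 / 4 \<le> \<alpha>"
  obtains C where "0 < C"
    "\<And>x::'a::euclidean_space. norm (heat_transform \<alpha> x) \<le> C * (1 + norm x) powr (- (real DIM('a) + 1 / 2))"
proof -
  define q where "q = real DIM('a) + 1 / 2"
  define m where "m = Suc DIM('a)"
  let ?g = "\<lambda>\<xi>::'a. exp (- (norm \<xi> powr (2 * \<alpha>)))"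
  define G where "G = (\<integral>\<xi>. ?g \<xi> \<partial>lborel)"
  obtain C where C: "0 < C" "\<And>\<xi> h::'a. h \<noteq> 0 \<Longrightarrow> \<bar>fdiff m h ?g \<xi>\<bar>
      \<le> C * norm h powr (1 / 2) * (1 + norm \<xi> / norm h) powr (- q)"
    using fdiff_heat_symbol_bound[OF \<alpha>, where 'a='a] unfolding m_def q_def by blast
  have "(\<integral>\<^sup>+x. ennreal ((1 + norm (x::'a)) powr (- q)) \<partial>lborel) < \<infinity>"
    by (rule nn_integral_one_plus_norm_powr_finite) (simp add: q_def)
  then obtain J where J: "J \<ge> 0" "(\<integral>\<^sup>+x. ennreal ((1 + norm (x::'a)) powr (- q)) \<partial>lborel) = ennreal J"
    by (auto simp: less_top elim: ennreal_cases)
  note int = integrable_heat_symbol[OF \<alpha>, where 'a='a]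
  have G: "norm (heat_transform \<alpha> x) \<le> G" for x :: 'a
  proof -
    have "norm (heat_transform \<alpha> x) \<le> (\<integral>\<xi>. norm (cis (x \<bullet> \<xi>) * complex_of_real (?g \<xi>)) \<partial>lborel)"
      unfolding heat_transform_def by (rule integral_norm_bound)
    then show ?thesis by (simp add: norm_mult G_def)
  qed
  have far: "norm (heat_transform \<alpha> x) \<le> C * J * pi powr q * norm x powr (- q)" if x: "x \<noteq> 0" for x :: 'a
  proof -
    define h where "h = (pi / (norm x)\<^sup>2) *\<^sub>R x"
    define \<eta> where "\<eta> = pi / norm x"
    have h: "h \<noteq> 0" "x \<bullet> h = pi" "norm h = \<eta>" "\<eta> > 0"
      using x by (auto simp: h_def \<eta>_def power2_norm_eq_inner dot_square_norm power2_eq_square)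
    note F = integral_cis_fdiff[OF int h(2), of m]
    have Fint: "integrable lborel (\<lambda>\<xi>. cis (x \<bullet> \<xi>) * complex_of_real (fdiff m h ?g \<xi>))"
      using F by (intro integrable_cis_inner_mult) simp
    \<comment> \<open>The factor \<open>2 ^ m >= 1\<close> is inserted because it is the modulus of
      \<open>(- 2) ^ m\<close> in \<open>integral_cis_fdiff\<close>.\<close>
    have "ennreal (norm (heat_transform \<alpha> x)) \<le> ennreal (2 ^ m * norm (heat_transform \<alpha> x))"
      by (intro ennreal_leI) (simp add: mult_le_cancel_right1)
    also have "2 ^ m * norm (heat_transform \<alpha> x)
        = norm (\<integral>\<xi>. cis (x \<bullet> \<xi>) * complex_of_real (fdiff m h ?g \<xi>) \<partial>lborel)"
      using F by (simp add: heat_transform_def norm_mult norm_power)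
    also have "ennreal \<dots> \<le> (\<integral>\<^sup>+\<xi>. ennreal (norm (cis (x \<bullet> \<xi>) * complex_of_real (fdiff m h ?g \<xi>))) \<partial>lborel)"
      by (rule integral_norm_bound_ennreal[OF Fint])
    also have "\<dots> \<le> (\<integral>\<^sup>+\<xi>. ennreal (C * \<eta> powr (1 / 2)) * ennreal ((1 + norm ((1 / \<eta>) *\<^sub>R (\<xi>::'a))) powr (- q)) \<partial>lborel)"
    proof (rule nn_integral_mono)
      fix \<xi> :: 'a
      have "norm ((1 / \<eta>) *\<^sub>R \<xi>) = norm \<xi> / \<eta>" using h(4) by simp
      then have "norm (cis (x \<bullet> \<xi>) * complex_of_real (fdiff m h ?g \<xi>))
          \<le> C * \<eta> powr (1 / 2) * (1 + norm ((1 / \<eta>) *\<^sub>R \<xi>)) powr (- q)"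
        using C(2)[OF h(1), of \<xi>] unfolding h(3) by (simp only: norm_mult norm_cis norm_of_real mult_1)
      then show "ennreal (norm (cis (x \<bullet> \<xi>) * complex_of_real (fdiff m h ?g \<xi>)))
          \<le> ennreal (C * \<eta> powr (1 / 2)) * ennreal ((1 + norm ((1 / \<eta>) *\<^sub>R \<xi>)) powr (- q))"
        using C(1) by (subst ennreal_mult[symmetric]) (auto intro!: ennreal_leI)
    qed
    also have "\<dots> = ennreal (C * \<eta> powr (1 / 2)) * (ennreal (1 / (1 / \<eta>) ^ DIM('a)) * ennreal J)"
      using h(4) by (subst nn_integral_cmult, simp)
        (subst nn_integral_lborel_scaleR[of "\<lambda>\<xi>. ennreal ((1 + norm \<xi>) powr (- q))"], auto simp: J)
    also have "\<dots> = ennreal (C * J * (\<eta> powr (1 / 2) * \<eta> ^ DIM('a)))"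
      using C(1) J(1) h(4) by (simp add: mult_ac power_one_over flip: ennreal_mult)
    also have "\<eta> powr (1 / 2) * \<eta> ^ DIM('a) = \<eta> powr q"
      using h(4) by (simp add: q_def add.commute flip: powr_realpow powr_add)
    also have "\<eta> powr q = pi powr q * norm x powr (- q)"
      by (simp add: \<eta>_def powr_divide powr_minus_divide)
    finally show ?thesis using C(1) J(1) by (simp add: ennreal_le_iff mult.assoc)
  qed
  have q0: "q \<ge> 0" by (simp add: q_def)
  define M where "M = G + C * J * pi powr q + 1"
  have G0: "0 \<le> G" by (simp add: G_def)
  then have M: "0 < M" "G \<le> M" "C * J * pi powr q \<le> M" using C(1) J(1) by (auto simp: M_def add_nonneg_pos)
  show ?thesis
  proof
    show "0 < M * 2 powr q" using M by simp
    fix x :: 'a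
    have "norm (heat_transform \<alpha> x) \<le> M * min 1 (norm x powr (- q))" if "x \<noteq> 0"
    proof -
      have "C * J * pi powr q * norm x powr (- q) \<le> M * norm x powr (- q)"
        using M by (intro mult_right_mono) auto
      with far[OF that] G[of x] M show ?thesis by (auto simp: min_def)
    qed
    also have "M * min 1 (norm x powr (- q)) \<le> M * (2 powr q * (1 + norm x) powr (- q))"
      using M q0 by (intro mult_left_mono min_one_powr_le) auto
    finally have "x \<noteq> 0 \<Longrightarrow> norm (heat_transform \<alpha> x) \<le> M * 2 powr q * (1 + norm x) powr (- q)"
      by (simp add: mult.assoc)
    moreover have "x = 0 \<Longrightarrow> norm (heat_transform \<alpha> x) \<le> M * 2 powr q * (1 + norm x) powr (- q)"
    proof -
      have "M * 1 \<le> M * 2 powr q" using M q0 by (intro mult_left_mono ge_one_powr_ge_zero) auto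
      then have "norm (heat_transform \<alpha> x) \<le> M * 2 powr q" using G[of x] M(2) by linarith
      then show "x = 0 \<Longrightarrow> ?thesis" by simp
    qed
    ultimately show "norm (heat_transform \<alpha> x) \<le> M * 2 powr q * (1 + norm x) powr (- (real DIM('a) + 1 / 2))"
      unfolding q_def by blast
  qed
qed

text \<open>With \<sigma> as chosen, \<open>s |\<xi>| powr (2 * \<alpha>)\<close> is
  \<open>|\<sigma> \<xi>| powr (2 * \<alpha>)\<close>, so substituting \<open>\<sigma> \<xi>\<close>
  reduces every time to time 1.\<close>

lemma frac_heat_kernel_eq:
  assumes "0 < \<alpha>" "0 < s"
  defines "\<sigma> \<equiv> s powr (1 / (2 * \<alpha>))"
  shows "frac_heat_kernel \<alpha> s (x :: real^'n)
    = (1 / (2 * pi) ^ CARD('n) * (1 / \<sigma> ^ CARD('n))) *\<^sub>R heat_transform \<alpha> ((1 / \<sigma>) *\<^sub>R x)"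
proof -
  have \<sigma>: "\<sigma> > 0" "\<sigma> powr (2 * \<alpha>) = s" using assms by (auto simp: powr_powr)
  let ?F = "\<lambda>\<xi>. cis (((1 / \<sigma>) *\<^sub>R x) \<bullet> \<xi>) * complex_of_real (exp (- (norm \<xi> powr (2 * \<alpha>))))"
  have "cis (x \<bullet> \<xi>) * complex_of_real (exp (- s * norm \<xi> powr (2 * \<alpha>))) = ?F (\<sigma> *\<^sub>R \<xi>)" for \<xi>
    using \<sigma> by (simp add: powr_mult)
  then show ?thesis
    using integral_lborel_scaleR[of ?F \<sigma>] \<sigma>
    by (simp add: frac_heat_kernel_def heat_transform_def)
qed

text \<open>By scaling, the supremum is of order \<open>1 / \<sigma> ^ n\<close>, which is the
  stated power of \<open>s\<close>, while in the integral this factor cancels against the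
  Jacobian.\<close>

lemma frac_heat_kernel_bounds:
  assumes \<alpha>: "1 / 4 \<le> \<alpha>"
  obtains B where "0 < B"
    "\<And>s. 0 < s \<Longrightarrow> (frac_heat_kernel \<alpha> s :: real^'n \<Rightarrow> complex) \<in> borel_measurable borel"
    "\<And>s x. 0 < s \<Longrightarrow> norm (frac_heat_kernel \<alpha> s (x::real^'n)) \<le> B * s powr (- (real CARD('n) / (2 * \<alpha>)))"
    "\<And>s. 0 < s \<Longrightarrow> (\<integral>\<^sup>+x. ennreal (norm (frac_heat_kernel \<alpha> s (x::real^'n))) \<partial>lborel) \<le> ennreal B"
proof -
  define n where "n = CARD('n)"
  define q where "q = real n + 1 / 2"
  obtain C where C: "0 < C" "\<And>x::real^'n. norm (heat_transform \<alpha> x) \<le> C * (1 + norm x) powr (- q)"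
    using heat_transform_decay[OF \<alpha>, where 'a="real^'n"] unfolding q_def n_def by auto
  have "(\<integral>\<^sup>+x. ennreal ((1 + norm (x::real^'n)) powr (- q)) \<partial>lborel) < \<infinity>"
    by (rule nn_integral_one_plus_norm_powr_finite) (simp add: q_def n_def)
  then obtain J where J: "J \<ge> 0" "(\<integral>\<^sup>+x. ennreal ((1 + norm (x::real^'n)) powr (- q)) \<partial>lborel) = ennreal J"
    by (auto simp: less_top elim: ennreal_cases)
  have \<alpha>0: "0 < \<alpha>" using \<alpha> by simp
  have p1: "1 / (2 * pi) ^ n \<le> 1"
  proof -
    have "1 \<le> (2 * pi) ^ n" using pi_ge_two by (intro one_le_power) linarith
    then show ?thesis by (subst divide_le_eq_1_pos) auto
  qed
  have q0: "q \<ge> 0" by (simp add: q_def)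
  show ?thesis
  proof
    \<comment> \<open>\<open>C\<close> serves for the supremum and \<open>C * J\<close> for the
      integral, so \<open>C * (J + 1)\<close> covers both; the Fourier normalisation is at most
      1.\<close>
    show "0 < C * (J + 1)" using C J by simp
    fix s :: real assume s: "0 < s"
    define \<sigma> where "\<sigma> = s powr (1 / (2 * \<alpha>))"
    have \<sigma>: "\<sigma> > 0" using s by (simp add: \<sigma>_def)
    have \<sigma>n: "1 / \<sigma> ^ n = s powr (- (real n / (2 * \<alpha>)))"
    proof -
      have "\<sigma> ^ n = \<sigma> powr real n" using \<sigma> by (simp add: powr_realpow)
      also have "\<dots> = s powr (real n / (2 * \<alpha>))" unfolding \<sigma>_def powr_powr by simp
      finally show ?thesis by (simp add: powr_minus_divide)
    qed
    note eq = frac_heat_kernel_eq[OF \<alpha>0 s, folded \<sigma>_def n_def]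
    have le: "norm (frac_heat_kernel \<alpha> s x) \<le> C * (1 / \<sigma> ^ n) * (1 + norm ((1 / \<sigma>) *\<^sub>R x)) powr (- q)"
      for x :: "real^'n"
    proof -
      have "norm (frac_heat_kernel \<alpha> s x) = 1 / (2 * pi) ^ n * (1 / \<sigma> ^ n * norm (heat_transform \<alpha> ((1 / \<sigma>) *\<^sub>R x)))"
        unfolding eq using \<sigma> by (simp add: abs_mult n_def)
      also have "\<dots> \<le> 1 * (1 / \<sigma> ^ n * (C * (1 + norm ((1 / \<sigma>) *\<^sub>R x)) powr (- q)))"
        by (intro mult_mono p1 mult_left_mono C(2)) (use \<sigma> C(1) in auto)
      finally show ?thesis by (simp add: mult_ac)
    qed
    show "(frac_heat_kernel \<alpha> s :: real^'n \<Rightarrow> complex) \<in> borel_measurable borel"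
      unfolding eq[abs_def] by measurable
    show "norm (frac_heat_kernel \<alpha> s x) \<le> C * (J + 1) * s powr (- (real CARD('n) / (2 * \<alpha>)))" for x :: "real^'n"
    proof -
      have "(1 + norm ((1 / \<sigma>) *\<^sub>R x)) powr (- q) \<le> 1 powr (- q)" using q0 by (intro powr_mono2') auto
      then have "C * (1 / \<sigma> ^ n) * (1 + norm ((1 / \<sigma>) *\<^sub>R x)) powr (- q) \<le> C * (1 / \<sigma> ^ n) * 1"
        using C \<sigma> by (intro mult_left_mono) auto
      also have "\<dots> \<le> C * (J + 1) * (1 / \<sigma> ^ n)" using C J \<sigma> by (simp add: divide_right_mono)
      finally show ?thesis using le[of x] unfolding \<sigma>n unfolding n_def by linarith
    qed
    have "(\<integral>\<^sup>+x. ennreal (norm (frac_heat_kernel \<alpha> s (x::real^'n))) \<partial>lborel)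
      \<le> (\<integral>\<^sup>+x. ennreal (C * (1 / \<sigma> ^ n)) * ennreal ((1 + norm ((1 / \<sigma>) *\<^sub>R (x::real^'n))) powr (- q)) \<partial>lborel)"
      using le C \<sigma> by (intro nn_integral_mono) (simp flip: ennreal_mult)
    also have "\<dots> = ennreal (C * (1 / \<sigma> ^ n)) * (ennreal (1 / (1 / \<sigma>) ^ n) * ennreal J)"
      using \<sigma> by (subst nn_integral_cmult, simp)
        (subst nn_integral_lborel_scaleR[of "\<lambda>\<xi>. ennreal ((1 + norm \<xi>) powr (- q))"], auto simp: J n_def)
    also have "\<dots> = ennreal (C * J)"
      using C J \<sigma> by (simp add: power_one_over flip: ennreal_mult)
    also have "\<dots> \<le> ennreal (C * (J + 1))" using C by (intro ennreal_leI) simp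
    finally show "(\<integral>\<^sup>+x. ennreal (norm (frac_heat_kernel \<alpha> s (x::real^'n))) \<partial>lborel) \<le> ennreal (C * (J + 1))" .
  qed
qed

section \<open>Smoothing estimates\<close>

text \<open>The convex function \<open>x powr r\<close> lies above its tangent at \<open>c\<close>.
  The terms are arranged without subtraction so that the inequality can be integrated in
  \<open>ennreal\<close>.\<close>

lemma tangent_powr_le:
  fixes r c x :: real
  assumes "1 \<le> r" "0 < c" "0 \<le> x"
  shows "r * c powr (r - 1) * x \<le> x powr r + (r - 1) * c powr r"
proof (cases "r = 1")
  case False
  then have r: "r > 1" using assms by simp
  have "x * c powr (r - 1) \<le> x powr r / r + (c powr (r - 1)) powr (r / (r - 1)) / (r / (r - 1))"
    by (rule Youngs_inequality) (use r assms in \<open>auto simp: field_simps\<close>)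
  also have "(c powr (r - 1)) powr (r / (r - 1)) = c powr r"
    using r by (simp add: powr_powr)
  finally have "r * (x * c powr (r - 1)) \<le> r * (x powr r / r + c powr r / (r / (r - 1)))"
    using r by simp
  also have "r * (x powr r / r + c powr r / (r / (r - 1))) = x powr r + (r - 1) * c powr r"
    using r by (simp add: distrib_left)
  finally show ?thesis by (simp add: mult_ac)
qed (use assms in auto)

text \<open>Jensen's inequality for the measure with density \<open>w\<close>, whose mass is merely
  bounded by \<open>W\<close>: integrate the tangent inequality at a suitable
  \<open>c\<close>.\<close>

lemma nn_integral_weighted_power_mean:
  fixes w h :: "'a \<Rightarrow> real"
  assumes [measurable]: "w \<in> borel_measurable M" "h \<in> borel_measurable M"
    and nonneg: "\<And>x. 0 \<le> w x" "\<And>x. 0 \<le> h x" and r: "1 \<le> r" and W: "0 < W" and H: "0 \<le> H"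
    and wW: "(\<integral>\<^sup>+x. ennreal (w x) \<partial>M) \<le> ennreal W"
    and wH: "(\<integral>\<^sup>+x. ennreal (w x * h x powr r) \<partial>M) \<le> ennreal H"
  shows "(\<integral>\<^sup>+x. ennreal (w x * h x) \<partial>M) \<le> ennreal (W powr (1 - 1 / r) * H powr (1 / r))"
proof (cases "H = 0")
  case True
  then have "AE x in M. ennreal (w x * h x powr r) = 0"
    using wH by (subst nn_integral_0_iff_AE[symmetric]) auto
  then have "AE x in M. ennreal (w x * h x) = 0"
    by eventually_elim (auto simp: mult_le_0_iff zero_less_mult_iff not_less ennreal_eq_0_iff nonneg antisym)
  then have "(\<integral>\<^sup>+x. ennreal (w x * h x) \<partial>M) = 0"
    by (subst nn_integral_0_iff_AE) auto
  then show ?thesis by simp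
next
  case False
  then have H0: "H > 0" using H by simp
  \<comment> \<open>This \<open>c\<close> gives \<open>(r - 1) * c powr r * W = (r - 1) * H\<close>,
    so the right-hand side sums to \<open>r * H\<close>. It has to be positive, which is why
    \<open>H = 0\<close> was treated separately.\<close>
  define c where "c = (H / W) powr (1 / r)"
  have c: "c > 0" "c powr r = H / W" using H0 W r by (auto simp: c_def powr_powr)
  have "ennreal (r * c powr (r - 1)) * (\<integral>\<^sup>+x. ennreal (w x * h x) \<partial>M)
      = (\<integral>\<^sup>+x. ennreal (r * c powr (r - 1) * (w x * h x)) \<partial>M)"
    using r nonneg by (subst nn_integral_cmult[symmetric]) (auto simp: ennreal_mult)
  also have "\<dots> \<le> (\<integral>\<^sup>+x. ennreal (w x * h x powr r) + ennreal ((r - 1) * c powr r) * ennreal (w x) \<partial>M)"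
  proof (rule nn_integral_mono)
    fix x
    have "w x * (r * c powr (r - 1) * h x) \<le> w x * (h x powr r + (r - 1) * c powr r)"
      by (intro mult_left_mono tangent_powr_le nonneg r c)
    then have "r * c powr (r - 1) * (w x * h x) \<le> w x * h x powr r + (r - 1) * c powr r * w x"
      by (simp add: algebra_simps)
    then show "ennreal (r * c powr (r - 1) * (w x * h x)) \<le> ennreal (w x * h x powr r) + ennreal ((r - 1) * c powr r) * ennreal (w x)"
      using r nonneg by (simp add: ennreal_leI flip: ennreal_mult ennreal_plus)
  qed
  also have "\<dots> = (\<integral>\<^sup>+x. ennreal (w x * h x powr r) \<partial>M) + ennreal ((r - 1) * c powr r) * (\<integral>\<^sup>+x. ennreal (w x) \<partial>M)"
    by (subst nn_integral_add) (auto simp: nn_integral_cmult)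
  also have "\<dots> \<le> ennreal H + ennreal ((r - 1) * c powr r) * ennreal W"
    by (intro add_mono mult_left_mono wW wH) auto
  also have "\<dots> = ennreal (r * H)"
  proof -
    have "ennreal ((r - 1) * c powr r) * ennreal W = ennreal ((r - 1) * c powr r * W)"
      using W r by (intro ennreal_mult[symmetric]) auto
    also have "(r - 1) * c powr r * W = (r - 1) * H" using W c(2) by simp
    also have "ennreal H + ennreal ((r - 1) * H) = ennreal (H + (r - 1) * H)"
      using H r by (intro ennreal_plus[symmetric]) auto
    finally show ?thesis by (simp add: algebra_simps)
  qed
  finally have main: "ennreal (r * c powr (r - 1)) * (\<integral>\<^sup>+x. ennreal (w x * h x) \<partial>M) \<le> ennreal (r * H)" .
  define k where "k = r * c powr (r - 1)"
  have k: "k > 0" using r c by (simp add: k_def)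
  then have "(\<integral>\<^sup>+x. ennreal (w x * h x) \<partial>M) = ennreal (1 / k)
      * (ennreal k * (\<integral>\<^sup>+x. ennreal (w x * h x) \<partial>M))"
    by (simp add: mult.assoc[symmetric] flip: ennreal_mult)
  also have "\<dots> \<le> ennreal (1 / k) * ennreal (r * H)"
    unfolding k_def by (intro mult_left_mono main) simp
  also have "\<dots> = ennreal (H / c powr (r - 1))"
    using r H0 k by (simp add: k_def flip: ennreal_mult)
  also have "H / c powr (r - 1) = W powr (1 - 1 / r) * H powr (1 / r)"
  proof -
    have "H / c powr (r - 1) = W * c"
      using c W H0 by (simp add: powr_diff field_simps)
    also have "\<dots> = W powr (1 - 1 / r) * H powr (1 / r)"
      using W H0 by (simp add: c_def powr_divide powr_diff)
    finally show ?thesis .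
  qed
  finally show ?thesis .
qed

lemma enn_powr_mono:
  assumes "x \<le> ennreal y" "0 \<le> y" "0 \<le> a"
  shows "enn_powr x a \<le> ennreal (y powr a)"
proof -
  have "x \<noteq> top" using assms(1) by (auto simp: top_unique)
  moreover have "enn2real x \<le> y" using assms by (simp add: enn2real_leI)
  ultimately show ?thesis
    using assms by (auto simp: enn_powr_def intro!: ennreal_leI powr_mono2)
qed

lemma Lp_norm_top_le:
  assumes "f \<in> borel_measurable borel" "\<And>x. norm (f x) \<le> S"
  shows "Lp_norm \<infinity> f \<le> ennreal S"
  using assms unfolding Lp_norm_def by (auto intro!: esssup_I ennreal_leI)

lemma Lp_norm_le:
  assumes "(\<integral>\<^sup>+x. ennreal (norm (f x) powr p) \<partial>lborel) \<le> ennreal X" "0 \<le> X" "0 < p"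
  shows "Lp_norm (ereal p) f \<le> ennreal (X powr (1 / p))"
  using assms unfolding Lp_norm_def by (auto intro!: enn_powr_mono)

lemma in_Lp_ereal:
  assumes "in_Lp (ereal r) f" "0 < r"
  obtains H where "0 \<le> H" "(\<integral>\<^sup>+x. ennreal (norm (f x) powr r) \<partial>lborel) = ennreal H"
    "Lp_norm (ereal r) f = ennreal (H powr (1 / r))" "f \<in> borel_measurable borel"
proof -
  have "(\<integral>\<^sup>+x. ennreal (norm (f x) powr r) \<partial>lborel) \<noteq> top"
    using assms by (auto simp: in_Lp_def Lp_norm_def enn_powr_def split: if_splits)
  then obtain H where H: "0 \<le> H" "(\<integral>\<^sup>+x. ennreal (norm (f x) powr r) \<partial>lborel) = ennreal H"
    by (auto elim: ennreal_cases)
  moreover have "Lp_norm (ereal r) f = ennreal (H powr (1 / r))"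
    using H by (simp add: Lp_norm_def enn_powr_def)
  ultimately show thesis using that assms by (auto simp: in_Lp_def)
qed

section \<open>Convolution with a bounded integrable kernel\<close>

context
  fixes K f :: "real^'n \<Rightarrow> complex" and B a r H :: real
  assumes K [measurable]: "K \<in> borel_measurable borel" and f [measurable]: "f \<in> borel_measurable borel"
    and B: "0 < B" and a: "0 < a" and r: "1 \<le> r" and H: "0 \<le> H"
    and K_sup: "\<And>x. norm (K x) \<le> B * a"
    and K_int: "(\<integral>\<^sup>+x. ennreal (norm (K x)) \<partial>lborel) \<le> ennreal B"
    and f_int: "(\<integral>\<^sup>+x. ennreal (norm (f x) powr r) \<partial>lborel) \<le> ennreal H"
begin

text \<open>The convolution of \<open>|K|\<close> with \<open>|f| powr r\<close>. Its supremum and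
  its integral yield the endpoints \<open>p = \<infinity>\<close> and \<open>p = r\<close>.\<close>

private definition \<Phi> where "\<Phi> x = (\<integral>\<^sup>+y. ennreal (norm (K (x - y)) * norm (f y) powr r) \<partial>lborel)"

private lemma \<Phi>_le: "\<Phi> x \<le> ennreal (B * a * H)"
proof -
  have "\<Phi> x \<le> (\<integral>\<^sup>+y. ennreal (B * a) * ennreal (norm (f y) powr r) \<partial>lborel)"
    unfolding \<Phi>_def using B a
    by (intro nn_integral_mono) (auto simp flip: ennreal_mult intro!: ennreal_leI mult_right_mono K_sup)
  also have "\<dots> \<le> ennreal (B * a) * ennreal H"
    by (subst nn_integral_cmult) (auto intro!: mult_left_mono f_int)
  finally show ?thesis using B a H by (simp add: ennreal_mult)
qed

private lemma nn_integral_\<Phi>_le: "(\<integral>\<^sup>+x. \<Phi> x \<partial>lborel) \<le> ennreal (B * H)"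
proof -
  have "(\<integral>\<^sup>+x. \<Phi> x \<partial>lborel) = (\<integral>\<^sup>+y. (\<integral>\<^sup>+x. ennreal (norm (K (x - y)) * norm (f y) powr r) \<partial>lborel) \<partial>lborel)"
    unfolding \<Phi>_def by (rule lborel_pair.Fubini') measurable
  also have "\<dots> = (\<integral>\<^sup>+y. (\<integral>\<^sup>+x. ennreal (norm (K x)) \<partial>lborel) * ennreal (norm (f y) powr r) \<partial>lborel)"
    by (simp add: ennreal_mult nn_integral_multc nn_integral_lborel_minus_right[of "\<lambda>x. ennreal (norm (K x))"])
  also have "\<dots> = (\<integral>\<^sup>+x. ennreal (norm (K x)) \<partial>lborel) * (\<integral>\<^sup>+y. ennreal (norm (f y) powr r) \<partial>lborel)"
    by (subst nn_integral_cmult) auto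
  also have "\<dots> \<le> ennreal B * ennreal H" by (intro mult_mono K_int f_int) auto
  finally show ?thesis using B H by (simp add: ennreal_mult)
qed

text \<open>The power mean inequality with weight \<open>|K (x - y)|\<close>, whose mass in
  \<open>y\<close> is at most \<open>B\<close> by reflection and translation.\<close>

private lemma nn_integral_conv_le:
  "(\<integral>\<^sup>+y. ennreal (norm (K (x - y) * f y)) \<partial>lborel)
    \<le> ennreal (B powr (1 - 1 / r) * enn2real (\<Phi> x) powr (1 / r))"
proof -
  have "(\<integral>\<^sup>+y. ennreal (norm (K (x - y))) \<partial>lborel) \<le> ennreal B"
    using K_int nn_integral_lborel_minus_left[of "\<lambda>x. ennreal (norm (K x))" x] by simp
  moreover have "\<Phi> x < top" using \<Phi>_le[of x] by (rule le_less_trans) simp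
  then have "(\<integral>\<^sup>+y. ennreal (norm (K (x - y)) * norm (f y) powr r) \<partial>lborel) \<le> ennreal (enn2real (\<Phi> x))"
    by (simp add: \<Phi>_def)
  ultimately show ?thesis
    unfolding norm_mult by (intro nn_integral_weighted_power_mean) (use B r in auto)
qed

lemma integrable_convolution: "integrable lborel (\<lambda>y. K (x - y) * f y)"
  by (intro integrableI_bounded) (auto intro: le_less_trans[OF nn_integral_conv_le])

private lemma norm_conv_le:
  "norm (\<integral>y. K (x - y) * f y \<partial>lborel) \<le> B powr (1 - 1 / r) * enn2real (\<Phi> x) powr (1 / r)"
proof -
  have "ennreal (norm (\<integral>y. K (x - y) * f y \<partial>lborel)) \<le> (\<integral>\<^sup>+y. ennreal (norm (K (x - y) * f y)) \<partial>lborel)"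
    by (rule integral_norm_bound_ennreal[OF integrable_convolution])
  also note nn_integral_conv_le
  finally show ?thesis by (simp add: ennreal_le_iff)
qed

private lemma norm_conv_le_sup:
  "norm (\<integral>y. K (x - y) * f y \<partial>lborel) \<le> B * a powr (1 / r) * H powr (1 / r)"
proof -
  have "enn2real (\<Phi> x) \<le> B * a * H" using \<Phi>_le B a H by (intro enn2real_leI) auto
  then have "B powr (1 - 1 / r) * enn2real (\<Phi> x) powr (1 / r) \<le> B powr (1 - 1 / r) * (B * a * H) powr (1 / r)"
    using r by (intro mult_left_mono powr_mono2) auto
  also have "\<dots> = B * a powr (1 / r) * H powr (1 / r)"
    using B a H by (simp add: powr_mult powr_diff)
  finally show ?thesis using norm_conv_le[of x] by linarith
qed

private lemma nn_integral_norm_conv_powr_le: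
  "(\<integral>\<^sup>+x. ennreal (norm (\<integral>y. K (x - y) * f y \<partial>lborel) powr r) \<partial>lborel) \<le> ennreal (B powr r * H)"
proof -
  have "(\<integral>\<^sup>+x. ennreal (norm (\<integral>y. K (x - y) * f y \<partial>lborel) powr r) \<partial>lborel)
      \<le> (\<integral>\<^sup>+x. ennreal (B powr (r - 1)) * \<Phi> x \<partial>lborel)"
  proof (rule nn_integral_mono)
    fix x
    have fin: "\<Phi> x < top" using \<Phi>_le[of x] by (rule le_less_trans) simp
    have "norm (\<integral>y. K (x - y) * f y \<partial>lborel) powr r \<le> (B powr (1 - 1 / r) * enn2real (\<Phi> x) powr (1 / r)) powr r"
      using r by (intro powr_mono2 norm_conv_le) auto
    also have "\<dots> = B powr (r - 1) * enn2real (\<Phi> x)"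
    proof -
      have "(1 - 1 / r) * r = r - 1" using r by (simp add: field_simps)
      then show ?thesis using r B by (simp add: powr_mult powr_powr)
    qed
    finally have "ennreal (norm (\<integral>y. K (x - y) * f y \<partial>lborel) powr r) \<le> ennreal (B powr (r - 1) * enn2real (\<Phi> x))"
      by (rule ennreal_leI)
    also have "\<dots> = ennreal (B powr (r - 1)) * \<Phi> x" using fin by (simp add: ennreal_mult)
    finally show "ennreal (norm (\<integral>y. K (x - y) * f y \<partial>lborel) powr r) \<le> \<dots>" .
  qed
  also have "\<dots> = ennreal (B powr (r - 1)) * (\<integral>\<^sup>+x. \<Phi> x \<partial>lborel)"
    unfolding \<Phi>_def by (rule nn_integral_cmult) measurable
  also have "\<dots> \<le> ennreal (B powr (r - 1)) * ennreal (B * H)"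
    by (intro mult_left_mono nn_integral_\<Phi>_le) auto
  also have "\<dots> = ennreal (B powr r * H)"
    using B H by (simp add: powr_diff flip: ennreal_mult)
  finally show ?thesis .
qed

text \<open>For finite \<open>t >= r\<close> the bound
  \<open>|v| powr t <= S powr (t - r) * |v| powr r\<close>, with \<open>S\<close> the supremum
  bound, interpolates between the endpoints. The term \<open>real_of_ereal (inverse p)\<close> is
  \<open>1 / p\<close>, and 0 for infinite \<open>p\<close>.\<close>

lemma Lp_norm_convolution_le:
  assumes p: "ereal r \<le> p"
  shows "Lp_norm p (\<lambda>x. \<integral>y. K (x - y) * f y \<partial>lborel)
    \<le> ennreal (B * a powr (1 / r - real_of_ereal (inverse p)) * H powr (1 / r))"
proof (cases p)
  case (real t)
  let ?v = "\<lambda>x. \<integral>y. K (x - y) * f y \<partial>lborel"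
  define S where "S = B * a powr (1 / r) * H powr (1 / r)"
  have S: "S \<ge> 0" using B by (simp add: S_def)
  have t: "r \<le> t" using p real by simp
  have "(\<integral>\<^sup>+x. ennreal (norm (?v x) powr t) \<partial>lborel)
      \<le> (\<integral>\<^sup>+x. ennreal (S powr (t - r)) * ennreal (norm (?v x) powr r) \<partial>lborel)"
  proof (rule nn_integral_mono)
    fix x
    have "norm (?v x) powr t = norm (?v x) powr (t - r) * norm (?v x) powr r"
      by (simp flip: powr_add)
    also have "\<dots> \<le> S powr (t - r) * norm (?v x) powr r"
      using norm_conv_le_sup[of x] t by (intro mult_right_mono powr_mono2) (auto simp: S_def)
    finally show "ennreal (norm (?v x) powr t) \<le> ennreal (S powr (t - r)) * ennreal (norm (?v x) powr r)"
      by (simp add: ennreal_leI flip: ennreal_mult)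
  qed
  also have "\<dots> = ennreal (S powr (t - r)) * (\<integral>\<^sup>+x. ennreal (norm (?v x) powr r) \<partial>lborel)"
    by (rule nn_integral_cmult) measurable
  also have "\<dots> \<le> ennreal (S powr (t - r)) * ennreal (B powr r * H)"
    by (intro mult_left_mono nn_integral_norm_conv_powr_le) auto
  also have "\<dots> = ennreal (S powr (t - r) * (B powr r * H))"
    using H by (simp flip: ennreal_mult)
  finally have "Lp_norm (ereal t) ?v \<le> ennreal ((S powr (t - r) * (B powr r * H)) powr (1 / t))"
    using t r H by (intro Lp_norm_le) auto
  also have "(S powr (t - r) * (B powr r * H)) powr (1 / t) = B * a powr (1 / r - 1 / t) * H powr (1 / r)"
  proof (cases "H = 0")
    case False
    then have H0: "H > 0" using H by simp
    have "S powr (t - r) * (B powr r * H)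
        = (B powr (t - r) * B powr r) * a powr (1 / r * (t - r)) * (H powr (1 / r * (t - r)) * H powr 1)"
      using B a H0 by (simp add: S_def powr_mult powr_powr mult_ac)
    also have "\<dots> = B powr t * a powr (1 / r * (t - r)) * H powr (1 / r * (t - r) + 1)"
      unfolding powr_add[symmetric] by simp
    also have "1 / r * (t - r) = (1 / r - 1 / t) * t" using r t by (simp add: field_simps)
    also have "(1 / r - 1 / t) * t + 1 = 1 / r * t" using r t by (simp add: field_simps)
    finally have "S powr (t - r) * (B powr r * H) = B powr t * (a powr (1 / r - 1 / t)) powr t * (H powr (1 / r)) powr t"
      unfolding powr_powr .
    also have "\<dots> = (B * a powr (1 / r - 1 / t) * H powr (1 / r)) powr t"
      using B by (simp add: powr_mult)
    finally show ?thesis using r t B by (simp add: powr_powr)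
  qed simp
  finally show ?thesis using real r t by (simp add: divide_inverse)
next
  case PInf
  have "(\<lambda>x. \<integral>y. K (x - y) * f y \<partial>lborel) \<in> borel_measurable borel" by measurable
  with PInf show ?thesis using norm_conv_le_sup by (auto intro!: Lp_norm_top_le)
qed (use p in auto)

end

text \<open>A crude triangle inequality suffices for a weak type bound. It follows from
  \<open>|u + v| <= 2 * max |u| |v|\<close>; the constant 4 is independent of \<open>p\<close>
  because \<open>2 * 2 powr t <= 4 powr t\<close> for \<open>t >= 1\<close>.\<close>

lemma Lp_norm_add_le:
  fixes u v :: "real^'n \<Rightarrow> complex"
  assumes [measurable]: "u \<in> borel_measurable borel" "v \<in> borel_measurable borel"
    and p: "1 \<le> p" and u: "Lp_norm p u \<le> ennreal A" and v: "Lp_norm p v \<le> ennreal A" and A: "0 \<le> A"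
  shows "Lp_norm p (\<lambda>x. u x + v x) \<le> ennreal (4 * A)"
proof (cases p)
  case (real t)
  then have t: "t \<ge> 1" using p by simp
  have le: "(\<integral>\<^sup>+x. ennreal (norm (w x) powr t) \<partial>lborel) \<le> ennreal (A powr t)"
    if "Lp_norm p w \<le> ennreal A" for w :: "real^'n \<Rightarrow> complex"
  proof -
    let ?I = "\<integral>\<^sup>+x. ennreal (norm (w x) powr t) \<partial>lborel"
    have e: "enn_powr ?I (1 / t) \<le> ennreal A" using that real by (simp add: Lp_norm_def)
    then have fin: "?I \<noteq> top" by (auto simp: enn_powr_def top_unique)
    with e A have "enn2real ?I powr (1 / t) \<le> A" by (simp add: enn_powr_def ennreal_le_iff)
    then have "(enn2real ?I powr (1 / t)) powr t \<le> A powr t" using t by (intro powr_mono2) auto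
    then have "enn2real ?I \<le> A powr t" using t by (simp add: powr_powr)
    then have "ennreal (enn2real ?I) \<le> ennreal (A powr t)" by (rule ennreal_leI)
    then show ?thesis using fin by (subst (asm) ennreal_enn2real) (simp_all add: less_top)
  qed
  have "(\<integral>\<^sup>+x. ennreal (norm (u x + v x) powr t) \<partial>lborel)
      \<le> (\<integral>\<^sup>+x. ennreal (2 powr t) * (ennreal (norm (u x) powr t) + ennreal (norm (v x) powr t)) \<partial>lborel)"
  proof (rule nn_integral_mono)
    fix x
    let ?m = "max (norm (u x)) (norm (v x))"
    have "norm (u x + v x) powr t \<le> (2 * ?m) powr t"
      using norm_triangle_ineq[of "u x" "v x"] t by (intro powr_mono2) auto
    also have "\<dots> = 2 powr t * ?m powr t" by (simp add: powr_mult)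
    also have "\<dots> \<le> 2 powr t * (norm (u x) powr t + norm (v x) powr t)"
      by (intro mult_left_mono) (auto simp: max_def)
    finally show "ennreal (norm (u x + v x) powr t) \<le> ennreal (2 powr t) * (ennreal (norm (u x) powr t) + ennreal (norm (v x) powr t))"
      by (simp add: ennreal_leI flip: ennreal_mult ennreal_plus)
  qed
  also have "\<dots> = ennreal (2 powr t) * ((\<integral>\<^sup>+x. ennreal (norm (u x) powr t) \<partial>lborel) + (\<integral>\<^sup>+x. ennreal (norm (v x) powr t) \<partial>lborel))"
    by (subst nn_integral_cmult) (auto simp: nn_integral_add)
  also have "\<dots> \<le> ennreal (2 powr t) * (ennreal (A powr t) + ennreal (A powr t))"
    by (intro mult_left_mono add_mono le u v) auto
  also have "\<dots> = ennreal (2 powr t * (2 * A powr t))"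
    by (simp flip: ennreal_mult ennreal_plus)
  also have "\<dots> \<le> ennreal ((4 * A) powr t)"
  proof (intro ennreal_leI)
    have "2 powr 1 \<le> (2::real) powr t" using t by (intro powr_mono) auto
    then have "2 powr t * (2 * A powr t) \<le> 2 powr t * (2 powr t * A powr t)"
      by (intro mult_left_mono mult_right_mono) auto
    also have "\<dots> = (2 * (2 * A)) powr t" using A by (simp only: powr_mult mult_nonneg_nonneg zero_le_numeral)
    finally show "2 powr t * (2 * A powr t) \<le> (4 * A) powr t" by simp
  qed
  finally have "Lp_norm (ereal t) (\<lambda>x. u x + v x) \<le> ennreal (((4 * A) powr t) powr (1 / t))"
    using t by (intro Lp_norm_le) auto
  then show ?thesis using real t A by (simp add: powr_powr)
next
  case PInf
  have AE: "AE x in lborel. norm (w x) \<le> A" if "Lp_norm p w \<le> ennreal A" for w :: "real^'n \<Rightarrow> complex"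
  proof -
    have "esssup lborel (\<lambda>x. ennreal (norm (w x))) \<le> ennreal A" using that PInf by (simp add: Lp_norm_def)
    then have "AE x in lborel. ennreal (norm (w x)) \<le> ennreal A"
      using esssup_AE[where M=lborel and f="\<lambda>x. ennreal (norm (w x))"] by (auto elim: eventually_mono)
    then show ?thesis using A by (simp add: ennreal_le_iff)
  qed
  have "AE x in lborel. ennreal (norm (u x + v x)) \<le> ennreal (4 * A)"
    using AE[OF u] AE[OF v]
  proof eventually_elim
    case (elim x)
    then show ?case using norm_triangle_ineq[of "u x" "v x"] A by (intro ennreal_leI) linarith
  qed
  then show ?thesis unfolding Lp_norm_def using PInf by (auto intro!: esssup_I)
qed (use p in auto)

section \<open>Interpolation and the estimates in time\<close>

lemma nn_integral_layer_cake_square: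
  fixes t :: ennreal
  assumes "t < top"
  shows "t\<^sup>2 = (\<integral>\<^sup>+\<tau>. ennreal (2 * \<tau>) * indicator {\<tau>. 0 < \<tau> \<and> ennreal \<tau> < t} \<tau> \<partial>lborel)"
proof -
  obtain t' where t': "0 \<le> t'" "t = ennreal t'" using assms by (auto elim: ennreal_cases)
  have "(\<integral>\<^sup>+\<tau>. ennreal (2 * \<tau>) * indicator {\<tau>. 0 < \<tau> \<and> ennreal \<tau> < t} \<tau> \<partial>lborel)
      = (\<integral>\<^sup>+\<tau>. ennreal 2 * (ennreal (\<tau> powr 1) * indicator {0<..<t'} \<tau>) \<partial>lborel)"
    using t' by (intro nn_integral_cong) (auto simp: ennreal_less_iff ennreal_mult split: split_indicator)
  also have "\<dots> = ennreal 2 * ennreal (t' powr (1 + 1) / (1 + 1))"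
    by (subst nn_integral_cmult, simp, subst nn_integral_powr_greaterThanLessThan) (use t' in auto)
  also have "\<dots> = ennreal (2 * (t' powr (1 + 1) / (1 + 1)))" by (rule ennreal_mult[symmetric]) auto
  also have "\<dots> = t\<^sup>2" using t' by (simp add: ennreal_power)
  finally show ?thesis by simp
qed

lemma nn_integral_indicator_less_ennreal:
  "(\<integral>\<^sup>+s. indicator {s. 0 < s \<and> ennreal s < X} s \<partial>lborel) \<le> X"
proof (cases X)
  case (real x)
  have "{s. 0 < s \<and> ennreal s < X} = {0<..<x}" using real by (auto simp: ennreal_less_iff)
  then show ?thesis using real by simp
qed simp

text \<open>A Marcinkiewicz interpolation of a weak type \<open>(1,1)\<close> and a weak type \<open>(q,q)\<close> bound: the
  hypothesis on \<open>t\<close> is the weak type estimate for the two parts of \<open>f\<close> cut at height \<open>\<tau>\<close>.\<close>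
lemma marcinkiewicz_L2:
  fixes f :: "'a::euclidean_space \<Rightarrow> complex" and t :: "real \<Rightarrow> ennreal"
  assumes [measurable]: "f \<in> borel_measurable borel"
    and H: "(\<integral>\<^sup>+x. ennreal (norm (f x) powr 2) \<partial>lborel) = H"
    and q: "2 < q" and D: "0 \<le> D1" "0 \<le> D2"
    and fin: "\<And>s. 0 < s \<Longrightarrow> t s < top"
    and weak: "\<And>s \<tau>. 0 < s \<Longrightarrow> 0 < \<tau> \<Longrightarrow> ennreal \<tau> < t s \<Longrightarrow>
      ennreal s < ennreal (D1 / \<tau>) * (\<integral>\<^sup>+x. (if \<tau> < norm (f x) then ennreal (norm (f x)) else 0) \<partial>lborel) \<or>
      ennreal s < ennreal (D2 / \<tau> powr q) * (\<integral>\<^sup>+x. (if \<tau> < norm (f x) then 0 else ennreal (norm (f x) powr q)) \<partial>lborel)"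
  shows "(\<integral>\<^sup>+s\<in>{0<..}. (t s)\<^sup>2 \<partial>lborel) \<le> ennreal (2 * D1 + 2 * D2 / (q - 2)) * H"
proof -
  define a where "a = (\<lambda>\<tau>. \<integral>\<^sup>+x. (if \<tau> < norm (f x) then ennreal (norm (f x)) else 0) \<partial>lborel)"
  define b where "b = (\<lambda>\<tau>. \<integral>\<^sup>+x. (if \<tau> < norm (f x) then 0 else ennreal (norm (f x) powr q)) \<partial>lborel)"
  have [measurable]: "a \<in> borel_measurable borel" "b \<in> borel_measurable borel"
    unfolding a_def b_def by measurable
  define X where "X = (\<lambda>\<tau>. ennreal (D1 / \<tau>) * a \<tau>)"
  define Y where "Y = (\<lambda>\<tau>. ennreal (D2 / \<tau> powr q) * b \<tau>)"
  have [measurable]: "X \<in> borel_measurable borel" "Y \<in> borel_measurable borel"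
    unfolding X_def Y_def by measurable
  \<comment> \<open>The alternative in \<open>weak\<close> becomes a sum of two indicators on the
    quadrant of positive \<open>s\<close> and \<tau>. For fixed \<tau> the integral in
    \<open>s\<close> is then at most \<open>2 * \<tau> * (X \<tau> + Y \<tau>)\<close>.\<close>
  define W where "W = (\<lambda>s \<tau>. if 0 < \<tau> then ennreal (2 * \<tau>) *
      ((if 0 < s \<and> ennreal s < X \<tau> then 1 else 0) + (if 0 < s \<and> ennreal s < Y \<tau> then 1 else 0)) else 0)"
  have [measurable]: "case_prod W \<in> borel_measurable (borel \<Otimes>\<^sub>M borel)"
    unfolding W_def by measurable
  have "(\<integral>\<^sup>+s\<in>{0<..}. (t s)\<^sup>2 \<partial>lborel) \<le> (\<integral>\<^sup>+s. (\<integral>\<^sup>+\<tau>. W s \<tau> \<partial>lborel) \<partial>lborel)"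
  proof (rule nn_integral_mono)
    fix s :: real
    show "(t s)\<^sup>2 * indicator {0<..} s \<le> (\<integral>\<^sup>+\<tau>. W s \<tau> \<partial>lborel)"
    proof (cases "0 < s")
      case True
      have "(t s)\<^sup>2 = (\<integral>\<^sup>+\<tau>. ennreal (2 * \<tau>) * indicator {\<tau>. 0 < \<tau> \<and> ennreal \<tau> < t s} \<tau> \<partial>lborel)"
        by (rule nn_integral_layer_cake_square[OF fin[OF True]])
      also have "\<dots> \<le> (\<integral>\<^sup>+\<tau>. W s \<tau> \<partial>lborel)"
      proof (rule nn_integral_mono)
        fix \<tau> :: real
        have "ennreal s < X \<tau> \<or> ennreal s < Y \<tau>" if "0 < \<tau>" "ennreal \<tau> < t s"
          using weak[OF True that] by (simp add: X_def Y_def a_def b_def)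
        then show "ennreal (2 * \<tau>) * indicator {\<tau>. 0 < \<tau> \<and> ennreal \<tau> < t s} \<tau> \<le> W s \<tau>"
          using True by (auto simp: W_def distrib_left split: split_indicator)
      qed
      finally show ?thesis using True by simp
    qed simp
  qed
  also have "\<dots> = (\<integral>\<^sup>+\<tau>. (\<integral>\<^sup>+s. W s \<tau> \<partial>lborel) \<partial>lborel)"
    by (rule lborel_pair.Fubini') measurable
  also have "\<dots> \<le> (\<integral>\<^sup>+\<tau>. ennreal (2 * D1) * (a \<tau> * indicator {0<..} \<tau>)
      + ennreal (2 * D2) * (ennreal (\<tau> powr (1 - q)) * b \<tau> * indicator {0<..} \<tau>) \<partial>lborel)"
  proof (rule nn_integral_mono)
    fix \<tau> :: real
    show "(\<integral>\<^sup>+s. W s \<tau> \<partial>lborel) \<le> ennreal (2 * D1) * (a \<tau> * indicator {0<..} \<tau>)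
      + ennreal (2 * D2) * (ennreal (\<tau> powr (1 - q)) * b \<tau> * indicator {0<..} \<tau>)"
    proof (cases "0 < \<tau>")
      case True
      have "(\<integral>\<^sup>+s. W s \<tau> \<partial>lborel) = (\<integral>\<^sup>+s. ennreal (2 * \<tau>) *
          (indicator {s. 0 < s \<and> ennreal s < X \<tau>} s + indicator {s. 0 < s \<and> ennreal s < Y \<tau>} s) \<partial>lborel)"
        using True by (intro nn_integral_cong) (auto simp: W_def indicator_def)
      also have "\<dots> = ennreal (2 * \<tau>) * ((\<integral>\<^sup>+s. indicator {s. 0 < s \<and> ennreal s < X \<tau>} s \<partial>lborel)
          + (\<integral>\<^sup>+s. indicator {s. 0 < s \<and> ennreal s < Y \<tau>} s \<partial>lborel))"
        by (subst nn_integral_cmult) (measurable, simp add: nn_integral_add)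
      also have "\<dots> \<le> ennreal (2 * \<tau>) * (X \<tau> + Y \<tau>)"
        by (intro mult_left_mono add_mono nn_integral_indicator_less_ennreal) auto
      also have "\<dots> = ennreal (2 * \<tau>) * ennreal (D1 / \<tau>) * a \<tau> + ennreal (2 * \<tau>) * ennreal (D2 / \<tau> powr q) * b \<tau>"
        by (simp add: X_def Y_def distrib_left mult.assoc)
      also have "ennreal (2 * \<tau>) * ennreal (D1 / \<tau>) = ennreal (2 * D1)"
        using True D by (simp flip: ennreal_mult)
      also have "ennreal (2 * \<tau>) * ennreal (D2 / \<tau> powr q) = ennreal (2 * D2) * ennreal (\<tau> powr (1 - q))"
        using True D by (simp add: powr_diff flip: ennreal_mult)
      finally show ?thesis using True by (simp add: mult.assoc)
    qed (simp add: W_def)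
  qed
  also have "\<dots> = ennreal (2 * D1) * (\<integral>\<^sup>+\<tau>. a \<tau> * indicator {0<..} \<tau> \<partial>lborel)
      + ennreal (2 * D2) * (\<integral>\<^sup>+\<tau>. ennreal (\<tau> powr (1 - q)) * b \<tau> * indicator {0<..} \<tau> \<partial>lborel)"
    by (subst nn_integral_add) (auto simp: nn_integral_cmult)
  \<comment> \<open>For fixed \<open>x\<close> the value \<open>|f x|\<close> is integrated over the
    heights below \<open>|f x|\<close>, which gives its square.\<close>
  also have "(\<integral>\<^sup>+\<tau>. a \<tau> * indicator {0<..} \<tau> \<partial>lborel) = H"
  proof -
    have "(\<integral>\<^sup>+\<tau>. a \<tau> * indicator {0<..} \<tau> \<partial>lborel)
        = (\<integral>\<^sup>+\<tau>. (\<integral>\<^sup>+x. (if 0 < \<tau> \<and> \<tau> < norm (f x) then ennreal (norm (f x)) else 0) \<partial>lborel) \<partial>lborel)"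
      by (intro nn_integral_cong) (auto simp: a_def split: split_indicator)
    also have "\<dots> = (\<integral>\<^sup>+x. (\<integral>\<^sup>+\<tau>. (if 0 < \<tau> \<and> \<tau> < norm (f x) then ennreal (norm (f x)) else 0) \<partial>lborel) \<partial>lborel)"
      by (rule lborel_pair.Fubini') measurable
    also have "\<dots> = (\<integral>\<^sup>+x. ennreal (norm (f x) powr 2) \<partial>lborel)"
    proof (rule nn_integral_cong)
      fix x
      have "(\<integral>\<^sup>+\<tau>. (if 0 < \<tau> \<and> \<tau> < norm (f x) then ennreal (norm (f x)) else 0) \<partial>lborel)
          = (\<integral>\<^sup>+\<tau>. ennreal (norm (f x)) * indicator {0<..<norm (f x)} \<tau> \<partial>lborel)"
        by (intro nn_integral_cong) auto
      also have "\<dots> = ennreal (norm (f x) powr 2)"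
        by (subst nn_integral_cmult_indicator) (auto simp: power2_eq_square simp flip: ennreal_mult)
      finally show "(\<integral>\<^sup>+\<tau>. (if 0 < \<tau> \<and> \<tau> < norm (f x) then ennreal (norm (f x)) else 0) \<partial>lborel)
          = ennreal (norm (f x) powr 2)" .
    qed
    finally show ?thesis using H by simp
  qed
  \<comment> \<open>For fixed \<open>x\<close> the integral of \<open>\<tau> powr (1 - q)\<close>
    over heights above \<open>|f x|\<close> is \<open>|f x| powr (2 - q) / (q - 2)\<close>;
    convergence at infinity is where \<open>q > 2\<close> enters.\<close>
  also have "(\<integral>\<^sup>+\<tau>. ennreal (\<tau> powr (1 - q)) * b \<tau> * indicator {0<..} \<tau> \<partial>lborel) = ennreal (1 / (q - 2)) * H"
  proof -
    have "(\<integral>\<^sup>+\<tau>. ennreal (\<tau> powr (1 - q)) * b \<tau> * indicator {0<..} \<tau> \<partial>lborel)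
        = (\<integral>\<^sup>+\<tau>. (\<integral>\<^sup>+x. (if 0 < \<tau> \<and> norm (f x) \<le> \<tau> then ennreal (\<tau> powr (1 - q) * norm (f x) powr q) else 0) \<partial>lborel) \<partial>lborel)"
    proof (rule nn_integral_cong)
      fix \<tau> :: real
      have "ennreal (\<tau> powr (1 - q)) * b \<tau> = (\<integral>\<^sup>+x. ennreal (\<tau> powr (1 - q)) * (if \<tau> < norm (f x) then 0 else ennreal (norm (f x) powr q)) \<partial>lborel)"
        unfolding b_def by (rule nn_integral_cmult[symmetric]) measurable
      also have "\<dots> = (\<integral>\<^sup>+x. (if norm (f x) \<le> \<tau> then ennreal (\<tau> powr (1 - q) * norm (f x) powr q) else 0) \<partial>lborel)"
        by (intro nn_integral_cong) (auto simp: ennreal_mult)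
      finally show "ennreal (\<tau> powr (1 - q)) * b \<tau> * indicator {0<..} \<tau>
          = (\<integral>\<^sup>+x. (if 0 < \<tau> \<and> norm (f x) \<le> \<tau> then ennreal (\<tau> powr (1 - q) * norm (f x) powr q) else 0) \<partial>lborel)"
        by (auto split: split_indicator)
    qed
    also have "\<dots> = (\<integral>\<^sup>+x. (\<integral>\<^sup>+\<tau>. (if 0 < \<tau> \<and> norm (f x) \<le> \<tau> then ennreal (\<tau> powr (1 - q) * norm (f x) powr q) else 0) \<partial>lborel) \<partial>lborel)"
      by (rule lborel_pair.Fubini') measurable
    also have "\<dots> = (\<integral>\<^sup>+x. ennreal (1 / (q - 2)) * ennreal (norm (f x) powr 2) \<partial>lborel)"
    proof (rule nn_integral_cong)
      fix x
      show "(\<integral>\<^sup>+\<tau>. (if 0 < \<tau> \<and> norm (f x) \<le> \<tau> then ennreal (\<tau> powr (1 - q) * norm (f x) powr q) else 0) \<partial>lborel)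
        = ennreal (1 / (q - 2)) * ennreal (norm (f x) powr 2)"
      proof (cases "f x = 0")
        case False
        then have "(\<integral>\<^sup>+\<tau>. (if 0 < \<tau> \<and> norm (f x) \<le> \<tau> then ennreal (\<tau> powr (1 - q) * norm (f x) powr q) else 0) \<partial>lborel)
            = (\<integral>\<^sup>+\<tau>. ennreal (norm (f x) powr q) * (ennreal (\<tau> powr (1 - q)) * indicator {norm (f x)..} \<tau>) \<partial>lborel)"
          by (intro nn_integral_cong) (auto simp: ennreal_mult mult_ac split: split_indicator intro: less_le_trans[of 0 "norm (f x)"])
        also have "\<dots> = ennreal (norm (f x) powr q) * ennreal (norm (f x) powr (1 - q + 1) / (- (1 - q) - 1))"
          by (subst nn_integral_cmult, simp, subst nn_integral_powr_atLeast) (use q False in auto)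
        also have "\<dots> = ennreal (norm (f x) powr q * norm (f x) powr (2 - q) / (q - 2))"
          using q by (simp flip: ennreal_mult)
        also have "norm (f x) powr q * norm (f x) powr (2 - q) = norm (f x) powr 2"
          by (simp flip: powr_add)
        finally show ?thesis using q by (simp flip: ennreal_mult)
      qed (simp cong: if_cong)
    qed
    also have "\<dots> = ennreal (1 / (q - 2)) * H" using H by (subst nn_integral_cmult) auto
    finally show ?thesis .
  qed
  also have "ennreal (2 * D1) * H + ennreal (2 * D2) * (ennreal (1 / (q - 2)) * H) = ennreal (2 * D1 + 2 * D2 / (q - 2)) * H"
    using D q by (simp add: distrib_right mult.assoc[symmetric] flip: ennreal_mult)
  finally show ?thesis .
qed

section \<open>Estimates for the semigroup and their integration in time\<close>

lemma borel_measurable_frac_heat: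
  fixes f :: "real^'n \<Rightarrow> complex"
  assumes \<alpha>: "1 / 4 \<le> \<alpha>" and s: "0 < s" and [measurable]: "f \<in> borel_measurable borel"
  shows "frac_heat \<alpha> s f \<in> borel_measurable borel"
proof -
  obtain B where "\<And>s. 0 < s \<Longrightarrow> (frac_heat_kernel \<alpha> s :: real^'n \<Rightarrow> complex) \<in> borel_measurable borel"
    using frac_heat_kernel_bounds[OF \<alpha>, where 'n='n] by blast
  from this[OF s] have [measurable]: "(frac_heat_kernel \<alpha> s :: real^'n \<Rightarrow> complex) \<in> borel_measurable borel" .
  show ?thesis using s unfolding frac_heat_def by simp
qed

lemma integrable_frac_heat_kernel_mult:
  fixes f :: "real^'n \<Rightarrow> complex"
  assumes \<alpha>: "1 / 4 \<le> \<alpha>" and s: "0 < s" and r: "1 \<le> r" and H: "0 \<le> H"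
    and f: "f \<in> borel_measurable borel"
    and fH: "(\<integral>\<^sup>+x. ennreal (norm (f x) powr r) \<partial>lborel) \<le> ennreal H"
  shows "integrable lborel (\<lambda>y. frac_heat_kernel \<alpha> s (x - y) * f y)"
proof -
  obtain B where B: "0 < B"
    "\<And>s. 0 < s \<Longrightarrow> (frac_heat_kernel \<alpha> s :: real^'n \<Rightarrow> complex) \<in> borel_measurable borel"
    "\<And>s x. 0 < s \<Longrightarrow> norm (frac_heat_kernel \<alpha> s (x::real^'n)) \<le> B * s powr (- (real CARD('n) / (2 * \<alpha>)))"
    "\<And>s. 0 < s \<Longrightarrow> (\<integral>\<^sup>+x. ennreal (norm (frac_heat_kernel \<alpha> s (x::real^'n))) \<partial>lborel) \<le> ennreal B"
    using frac_heat_kernel_bounds[OF \<alpha>, where 'n='n] by blast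
  have a: "0 < s powr (- (real CARD('n) / (2 * \<alpha>)))" using s by simp
  show ?thesis
    by (rule integrable_convolution[OF B(2)[OF s] f B(1) a r H B(3)[OF s] B(4)[OF s] fH])
qed

text \<open>One constant works for all exponents, so the same \<open>B\<close> can be used at both
  endpoints of the interpolation.\<close>

lemma frac_heat_smoothing:
  assumes \<alpha>: "1 / 4 \<le> \<alpha>"
  defines "\<nu> \<equiv> real CARD('n) / (2 * \<alpha>)"
  obtains B where "0 < B"
    "\<And>s r p H (f :: real^'n \<Rightarrow> complex). 0 < s \<Longrightarrow> 1 \<le> r \<Longrightarrow> ereal r \<le> p \<Longrightarrow> 0 \<le> H \<Longrightarrow> f \<in> borel_measurable borel \<Longrightarrow>
      (\<integral>\<^sup>+x. ennreal (norm (f x) powr r) \<partial>lborel) \<le> ennreal H \<Longrightarrow>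
      Lp_norm p (frac_heat \<alpha> s f)
        \<le> ennreal (B * s powr (- \<nu> * (1 / r - real_of_ereal (inverse p))) * H powr (1 / r))"
proof -
  obtain B where B: "0 < B"
    "\<And>s. 0 < s \<Longrightarrow> (frac_heat_kernel \<alpha> s :: real^'n \<Rightarrow> complex) \<in> borel_measurable borel"
    "\<And>s x. 0 < s \<Longrightarrow> norm (frac_heat_kernel \<alpha> s (x::real^'n)) \<le> B * s powr (- \<nu>)"
    "\<And>s. 0 < s \<Longrightarrow> (\<integral>\<^sup>+x. ennreal (norm (frac_heat_kernel \<alpha> s (x::real^'n))) \<partial>lborel) \<le> ennreal B"
    using frac_heat_kernel_bounds[OF \<alpha>, where 'n='n] unfolding \<nu>_def by blast
  show ?thesis
  proof
    show "0 < B" by fact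
    fix s r H :: real and p :: ereal and f :: "real^'n \<Rightarrow> complex"
    assume s: "0 < s" and r: "1 \<le> r" and p: "ereal r \<le> p" and H: "0 \<le> H" and f: "f \<in> borel_measurable borel"
      and fH: "(\<integral>\<^sup>+x. ennreal (norm (f x) powr r) \<partial>lborel) \<le> ennreal H"
    have a: "0 < s powr (- \<nu>)" using s by simp
    have "frac_heat \<alpha> s f = (\<lambda>x. \<integral>y. frac_heat_kernel \<alpha> s (x - y) * f y \<partial>lborel)"
      using s by (simp add: frac_heat_def)
    then show "Lp_norm p (frac_heat \<alpha> s f)
        \<le> ennreal (B * s powr (- \<nu> * (1 / r - real_of_ereal (inverse p))) * H powr (1 / r))"
      using Lp_norm_convolution_le[OF B(2)[OF s] f B(1) a r H B(3)[OF s] B(4)[OF s] fH p]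
      by (simp only: powr_powr)
  qed
qed

text \<open>The weight has exponent \<open>- \<nu> r / p\<close> and the \<open>r\<close>-th power
  of the smoothing bound has \<open>- \<nu> r (1/r - 1/p)\<close>. Their sum is
  \<open>- \<nu>\<close>, free of \<open>p\<close>, and integrable at 0 since
  \<open>\<nu> < 1\<close>.\<close>

lemma subcritical_estimate:
  fixes \<alpha> r :: real and p :: ereal
  assumes r: "1 \<le> r" and p: "ereal r \<le> p" and \<alpha>: "real CARD('n) < 2 * \<alpha>"
  shows "\<exists>C::real. C > 0 \<and>
        (\<forall>(T::real) (f :: real^'n \<Rightarrow> complex). 0 < T \<longrightarrow> in_Lp (ereal r) f \<longrightarrow>
          (\<integral>\<^sup>+ s \<in> {0<..<T}.
              ennreal (s powr (- real CARD('n) * r * real_of_ereal (inverse p) / (2 * \<alpha>)))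
              * enn_powr (Lp_norm p (frac_heat \<alpha> s f)) r \<partial>lborel)
          \<le> ennreal (C * T powr (1 - real CARD('n) / (2 * \<alpha>))) * enn_powr (Lp_norm (ereal r) f) r)"
proof -
  define \<nu> where "\<nu> = real CARD('n) / (2 * \<alpha>)"
  define \<iota> where "\<iota> = real_of_ereal (inverse p)"
  have n1: "1 \<le> real CARD('n)" by (simp add: Suc_le_eq)
  then have \<alpha>4: "1 / 4 \<le> \<alpha>" using \<alpha> by linarith
  have \<nu>: "\<nu> < 1" using \<alpha> \<alpha>4 by (simp add: \<nu>_def)
  obtain B where B: "0 < B"
    "\<And>s r p H (f :: real^'n \<Rightarrow> complex). 0 < s \<Longrightarrow> 1 \<le> r \<Longrightarrow> ereal r \<le> p \<Longrightarrow> 0 \<le> H \<Longrightarrow> f \<in> borel_measurable borel \<Longrightarrow>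
      (\<integral>\<^sup>+x. ennreal (norm (f x) powr r) \<partial>lborel) \<le> ennreal H \<Longrightarrow>
      Lp_norm p (frac_heat \<alpha> s f)
        \<le> ennreal (B * s powr (- \<nu> * (1 / r - real_of_ereal (inverse p))) * H powr (1 / r))"
    using frac_heat_smoothing[OF \<alpha>4, where 'n='n] unfolding \<nu>_def by blast
  show ?thesis
  proof (intro exI conjI allI impI)
    \<comment> \<open>\<open>B powr r\<close> is the smoothing constant raised to the power
      \<open>r\<close>, and \<open>1 / (1 - \<nu>)\<close> comes from integrating
      \<open>s powr (- \<nu>)\<close> up to \<open>T\<close>.\<close>
    show "0 < B powr r / (1 - \<nu>)" using B(1) \<nu> by simp
    fix T :: real and f :: "real^'n \<Rightarrow> complex"
    assume T: "0 < T" and f: "in_Lp (ereal r) f"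
    obtain H where H: "0 \<le> H" "(\<integral>\<^sup>+x. ennreal (norm (f x) powr r) \<partial>lborel) = ennreal H"
      "Lp_norm (ereal r) f = ennreal (H powr (1 / r))" "f \<in> borel_measurable borel"
      using in_Lp_ereal[OF f] r by auto
    have fr: "enn_powr (Lp_norm (ereal r) f) r = ennreal H"
      using H r by (simp add: enn_powr_def powr_powr)
    have "(\<integral>\<^sup>+ s \<in> {0<..<T}. ennreal (s powr (- real CARD('n) * r * \<iota> / (2 * \<alpha>)))
              * enn_powr (Lp_norm p (frac_heat \<alpha> s f)) r \<partial>lborel)
        \<le> (\<integral>\<^sup>+ s. ennreal (B powr r * H) * (ennreal (s powr (- \<nu>)) * indicator {0<..<T} s) \<partial>lborel)"
    proof (rule nn_integral_mono)
      fix s :: real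
      show "ennreal (s powr (- real CARD('n) * r * \<iota> / (2 * \<alpha>))) * enn_powr (Lp_norm p (frac_heat \<alpha> s f)) r
          * indicator {0<..<T} s \<le> ennreal (B powr r * H) * (ennreal (s powr (- \<nu>)) * indicator {0<..<T} s)"
      proof (cases "0 < s")
        case True
        have "enn_powr (Lp_norm p (frac_heat \<alpha> s f)) r
            \<le> ennreal ((B * s powr (- \<nu> * (1 / r - \<iota>)) * H powr (1 / r)) powr r)"
          unfolding \<iota>_def by (intro enn_powr_mono B(2)) (use True r p H B(1) in auto)
        also have "(B * s powr (- \<nu> * (1 / r - \<iota>)) * H powr (1 / r)) powr r
            = B powr r * s powr (- \<nu> * (1 / r - \<iota>) * r) * H"
          using B(1) H r by (simp add: powr_mult powr_powr)
        finally have "ennreal (s powr (- \<nu> * r * \<iota>)) * enn_powr (Lp_norm p (frac_heat \<alpha> s f)) r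
            \<le> ennreal (s powr (- \<nu> * r * \<iota>)) * ennreal (B powr r * s powr (- \<nu> * (1 / r - \<iota>) * r) * H)"
          by (intro mult_left_mono) auto
        also have "\<dots> = ennreal (B powr r * H * (s powr (- \<nu> * r * \<iota>) * s powr (- \<nu> * (1 / r - \<iota>) * r)))"
          using H by (simp add: mult_ac flip: ennreal_mult)
        also have "s powr (- \<nu> * r * \<iota>) * s powr (- \<nu> * (1 / r - \<iota>) * r) = s powr (- \<nu>)"
          unfolding powr_add[symmetric] using r by (simp add: algebra_simps)
        also have "- \<nu> * r * \<iota> = - real CARD('n) * r * \<iota> / (2 * \<alpha>)" by (simp add: \<nu>_def)
        finally show ?thesis using H by (simp add: ennreal_mult split: split_indicator)
      qed simp
    qed
    also have "\<dots> = ennreal (B powr r * H) * ennreal (T powr (- \<nu> + 1) / (- \<nu> + 1))"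
      by (subst nn_integral_cmult, simp, subst nn_integral_powr_greaterThanLessThan) (use \<nu> T in auto)
    also have "\<dots> = ennreal (B powr r / (1 - \<nu>) * T powr (1 - \<nu>)) * ennreal H"
      using H \<nu> by (simp add: mult_ac add.commute flip: ennreal_mult)
    finally show "(\<integral>\<^sup>+ s \<in> {0<..<T}. ennreal (s powr (- real CARD('n) * r * real_of_ereal (inverse p) / (2 * \<alpha>)))
              * enn_powr (Lp_norm p (frac_heat \<alpha> s f)) r \<partial>lborel)
        \<le> ennreal (B powr r / (1 - \<nu>) * T powr (1 - real CARD('n) / (2 * \<alpha>))) * enn_powr (Lp_norm (ereal r) f) r"
      unfolding fr \<iota>_def \<nu>_def .
  qed
qed

text \<open>Now \<open>\<nu> = 1\<close>, and direct integration of the smoothing bound would meet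
  the divergent integral of \<open>1 / s\<close>. Instead the bound is used with
  \<open>r = 1\<close> and with some \<open>r = q > 2\<close>, at the same \<open>p\<close>, and
  \<open>marcinkiewicz_L2\<close> gives the square integral.\<close>

lemma critical_estimate:
  fixes \<alpha> :: real and p :: ereal
  assumes p: "2 < p" and \<alpha>: "real CARD('n) = 2 * \<alpha>"
  shows "\<exists>C::real. C > 0 \<and>
        (\<forall>f :: real^'n \<Rightarrow> complex. in_Lp 2 f \<longrightarrow>
          (\<integral>\<^sup>+ s \<in> {0<..}.
              ennreal (s powr (- 2 * real_of_ereal (inverse p)))
              * (Lp_norm p (frac_heat \<alpha> s f))\<^sup>2 \<partial>lborel)
          \<le> ennreal C * (Lp_norm 2 f)\<^sup>2)"
proof -
  define \<iota> where "\<iota> = real_of_ereal (inverse p)"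
  have n1: "1 \<le> real CARD('n)" by (simp add: Suc_le_eq)
  then have \<alpha>4: "1 / 4 \<le> \<alpha>" using \<alpha> by linarith
  have \<nu>: "real CARD('n) / (2 * \<alpha>) = 1" using \<alpha> \<alpha>4 by simp
  obtain B where B: "0 < B"
    "\<And>s r p H (f :: real^'n \<Rightarrow> complex). 0 < s \<Longrightarrow> 1 \<le> r \<Longrightarrow> ereal r \<le> p \<Longrightarrow> 0 \<le> H \<Longrightarrow> f \<in> borel_measurable borel \<Longrightarrow>
      (\<integral>\<^sup>+x. ennreal (norm (f x) powr r) \<partial>lborel) \<le> ennreal H \<Longrightarrow>
      Lp_norm p (frac_heat \<alpha> s f)
        \<le> ennreal (B * s powr (- 1 * (1 / r - real_of_ereal (inverse p))) * H powr (1 / r))"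
    using frac_heat_smoothing[OF \<alpha>4, where 'n='n] unfolding \<nu> by blast
  have p1: "ereal 1 \<le> p" and p1': "1 \<le> p" and p2: "ereal 2 \<le> p" using p by (cases p; simp)+
  \<comment> \<open>The upper endpoint must satisfy \<open>2 < q <= p\<close> and be finite; for
    infinite \<open>p\<close> the value 3 is taken.\<close>
  obtain q where q: "2 < q" "ereal q \<le> p"
    using p by (cases p) (auto intro: that[of 3])
  \<comment> \<open>The factor 4 compensates the loss in \<open>Lp_norm_add_le\<close>.\<close>
  define D1 where "D1 = 4 * B"
  define D2 where "D2 = (4 * B) powr q"
  have D: "D1 > 0" "D2 > 0" using B(1) by (auto simp: D1_def D2_def)
  show ?thesis
  proof (intro exI conjI allI impI)
    show "0 < 2 * D1 + 2 * D2 / (q - 2)" using D q by (simp add: add_pos_pos)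
    fix f :: "real^'n \<Rightarrow> complex" assume f: "in_Lp 2 f"
    then have "in_Lp (ereal 2) f" by simp
    then obtain H where H: "0 \<le> H" "(\<integral>\<^sup>+x. ennreal (norm (f x) powr 2) \<partial>lborel) = ennreal H"
      "Lp_norm (ereal 2) f = ennreal (H powr (1 / 2))" "f \<in> borel_measurable borel"
      by (rule in_Lp_ereal) auto
    note [measurable] = H(4)
    have f2: "(Lp_norm 2 f)\<^sup>2 = ennreal H"
      using H by (simp add: ennreal_power powr_half_sqrt)
    define N where "N = (\<lambda>s. Lp_norm p (frac_heat \<alpha> s f))"
    have "(\<integral>\<^sup>+ s \<in> {0<..}. (ennreal (s powr (- \<iota>)) * N s)\<^sup>2 \<partial>lborel) \<le> ennreal (2 * D1 + 2 * D2 / (q - 2)) * ennreal H"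
    proof (rule marcinkiewicz_L2[OF H(4) H(2) q(1)])
      show "0 \<le> D1" "0 \<le> D2" using D by auto
      show "ennreal (s powr (- \<iota>)) * N s < top" if "0 < s" for s
      proof -
        have "N s \<le> ennreal (B * s powr (- 1 * (1 / 2 - real_of_ereal (inverse p))) * H powr (1 / 2))"
          unfolding N_def by (rule B(2)) (use that p2 H in auto)
        then have "N s < top" by (rule le_less_trans) simp
        then show ?thesis by (simp add: ennreal_mult_less_top)
      qed
      fix s \<tau> :: real assume s: "0 < s" and \<tau>: "0 < \<tau>" and less: "ennreal \<tau> < ennreal (s powr (- \<iota>)) * N s"
      \<comment> \<open>The cut at height \<tau>: the large values are estimated in
        \<open>L^1\<close>, the small ones in \<open>L^q\<close>.\<close>
      define f1 where "f1 = (\<lambda>x. if \<tau> < norm (f x) then f x else 0)"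
      define f2 where "f2 = (\<lambda>x. if \<tau> < norm (f x) then 0 else f x)"
      have f12 [measurable]: "f1 \<in> borel_measurable borel" "f2 \<in> borel_measurable borel"
        unfolding f1_def f2_def by measurable
      have I1: "(\<integral>\<^sup>+x. (if \<tau> < norm (f x) then ennreal (norm (f x)) else 0) \<partial>lborel) = (\<integral>\<^sup>+x. ennreal (norm (f1 x) powr 1) \<partial>lborel)"
        by (intro nn_integral_cong) (auto simp: f1_def)
      have I2: "(\<integral>\<^sup>+x. (if \<tau> < norm (f x) then 0 else ennreal (norm (f x) powr q)) \<partial>lborel) = (\<integral>\<^sup>+x. ennreal (norm (f2 x) powr q) \<partial>lborel)"
        by (intro nn_integral_cong) (auto simp: f2_def)
      \<comment> \<open>Negating an alternative also shows that the integral \<open>Z\<close> is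
        finite, so the smoothing bound becomes available for the corresponding part of
        \<open>f\<close>.\<close>
      have unscale: "Z \<le> ennreal (s / c)" if "\<not> ennreal s < ennreal c * Z" "0 < c" for c Z
      proof -
        have "Z = ennreal (1 / c) * (ennreal c * Z)"
          using \<open>0 < c\<close> by (simp add: mult.assoc[symmetric] flip: ennreal_mult)
        also have "\<dots> \<le> ennreal (1 / c) * ennreal s" using that by (intro mult_left_mono) auto
        also have "\<dots> = ennreal (s / c)" using that s by (simp flip: ennreal_mult)
        finally show ?thesis .
      qed
      show "ennreal s < ennreal (D1 / \<tau>) * (\<integral>\<^sup>+x. (if \<tau> < norm (f x) then ennreal (norm (f x)) else 0) \<partial>lborel) \<or>
        ennreal s < ennreal (D2 / \<tau> powr q) * (\<integral>\<^sup>+x. (if \<tau> < norm (f x) then 0 else ennreal (norm (f x) powr q)) \<partial>lborel)"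
      proof (rule ccontr)
        assume "\<not> ?thesis"
        then have not1: "\<not> ennreal s < ennreal (D1 / \<tau>) * (\<integral>\<^sup>+x. ennreal (norm (f1 x) powr 1) \<partial>lborel)"
          and not2: "\<not> ennreal s < ennreal (D2 / \<tau> powr q) * (\<integral>\<^sup>+x. ennreal (norm (f2 x) powr q) \<partial>lborel)"
          unfolding I1 I2 by blast+
        define H1 where "H1 = s / (D1 / \<tau>)"
        define H2 where "H2 = s / (D2 / \<tau> powr q)"
        have H0: "0 \<le> H1" "0 \<le> H2" using s \<tau> D by (auto simp: H1_def H2_def)
        have H1: "(\<integral>\<^sup>+x. ennreal (norm (f1 x) powr 1) \<partial>lborel) \<le> ennreal H1"
          unfolding H1_def by (rule unscale[OF not1]) (use D \<tau> in auto)
        have H2: "(\<integral>\<^sup>+x. ennreal (norm (f2 x) powr q) \<partial>lborel) \<le> ennreal H2"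
          unfolding H2_def by (rule unscale[OF not2]) (use D \<tau> in auto)
        have q1: "1 \<le> q" using q by simp
        \<comment> \<open>If both alternatives fail, each part has semigroup norm at most
          \<open>A\<close>. Hence the norm for \<open>f\<close> is at most
          \<open>4 * A = s powr \<iota> * \<tau>\<close>, contradicting \<open>less\<close>.\<close>
        define A where "A = s powr \<iota> * \<tau> / 4"
        have e1: "B * s powr (- 1 * (1 / 1 - \<iota>)) * H1 powr (1 / 1) = A"
          using s \<tau> B(1) by (simp add: H1_def D1_def A_def powr_diff field_simps)
        have e2: "B * s powr (- 1 * (1 / q - \<iota>)) * H2 powr (1 / q) = A"
        proof -
          have "H2 = s * (\<tau> / (4 * B)) powr q"
            using \<tau> B(1) by (simp add: H2_def D2_def powr_divide powr_mult)
          then have "H2 powr (1 / q) = s powr (1 / q) * (\<tau> / (4 * B))"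
            using s \<tau> B(1) q by (simp add: powr_mult powr_powr)
          moreover have "s powr (- 1 * (1 / q - \<iota>)) = s powr \<iota> / s powr (1 / q)"
            by (simp add: powr_diff)
          ultimately show ?thesis using s B(1) by (simp add: A_def)
        qed
        have "Lp_norm p (frac_heat \<alpha> s f1) \<le> ennreal A"
          using B(2)[OF s _ p1 H0(1) f12(1) H1] unfolding \<iota>_def[symmetric] e1 by simp
        moreover have "Lp_norm p (frac_heat \<alpha> s f2) \<le> ennreal A"
          using B(2)[OF s q1 q(2) H0(2) f12(2) H2] unfolding \<iota>_def[symmetric] e2 .
        ultimately have "Lp_norm p (\<lambda>x. frac_heat \<alpha> s f1 x + frac_heat \<alpha> s f2 x) \<le> ennreal (4 * A)"
          using s \<tau> by (intro Lp_norm_add_le borel_measurable_frac_heat \<alpha>4 p1' f12) (auto simp: A_def)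
        \<comment> \<open>Additivity of the Bochner integral needs both convolution integrals to
          converge, which the bounds \<open>H1\<close> and \<open>H2\<close> ensure.\<close>
        also have "(\<lambda>x. frac_heat \<alpha> s f1 x + frac_heat \<alpha> s f2 x) = frac_heat \<alpha> s f"
        proof
          fix x
          have "integrable lborel (\<lambda>y. frac_heat_kernel \<alpha> s (x - y) * f1 y)"
            "integrable lborel (\<lambda>y. frac_heat_kernel \<alpha> s (x - y) * f2 y)"
            using integrable_frac_heat_kernel_mult[OF \<alpha>4 s _ H0(1) f12(1) H1]
              integrable_frac_heat_kernel_mult[OF \<alpha>4 s q1 H0(2) f12(2) H2] by auto
          then have "frac_heat \<alpha> s f1 x + frac_heat \<alpha> s f2 x
              = (\<integral>y. frac_heat_kernel \<alpha> s (x - y) * f1 y + frac_heat_kernel \<alpha> s (x - y) * f2 y \<partial>lborel)"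
            using s by (simp add: frac_heat_def)
          also have "\<dots> = frac_heat \<alpha> s f x"
            using s by (auto simp: frac_heat_def f1_def f2_def intro!: Bochner_Integration.integral_cong)
          finally show "frac_heat \<alpha> s f1 x + frac_heat \<alpha> s f2 x = frac_heat \<alpha> s f x" .
        qed
        finally have "ennreal (s powr (- \<iota>)) * N s \<le> ennreal (s powr (- \<iota>)) * ennreal (4 * A)"
          unfolding N_def by (intro mult_left_mono) auto
        also have "\<dots> = ennreal \<tau>"
          using s \<tau> by (simp add: A_def powr_minus flip: ennreal_mult)
        finally show False using less by simp
      qed
    qed
    moreover have "ennreal (s powr (- 2 * \<iota>)) * (N s)\<^sup>2 = (ennreal (s powr (- \<iota>)) * N s)\<^sup>2" for s
    proof -
      have "s powr (- 2 * \<iota>) = (s powr (- \<iota>))\<^sup>2"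
        by (simp add: power2_eq_square flip: powr_add)
      then show ?thesis by (simp add: power_mult_distrib ennreal_power)
    qed
    ultimately show "(\<integral>\<^sup>+ s \<in> {0<..}. ennreal (s powr (- 2 * real_of_ereal (inverse p)))
              * (Lp_norm p (frac_heat \<alpha> s f))\<^sup>2 \<partial>lborel)
        \<le> ennreal (2 * D1 + 2 * D2 / (q - 2)) * (Lp_norm 2 f)\<^sup>2"
      unfolding f2 \<iota>_def N_def by simp
  qed
qed

theorem theorem1p7:
  fixes \<alpha> :: real
  assumes "\<alpha> > 0"
  shows
   "(\<forall>(r::real) (p::ereal). 1 \<le> r \<longrightarrow> ereal r \<le> p \<longrightarrow> real CARD('n) < 2 * \<alpha> \<longrightarrow>
      (\<exists>C::real. C > 0 \<and>
        (\<forall>(T::real) (f :: real^'n \<Rightarrow> complex). 0 < T \<longrightarrow> in_Lp (ereal r) f \<longrightarrow>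
          (\<integral>\<^sup>+ s \<in> {0<..<T}.
              ennreal (s powr (- real CARD('n) * r * real_of_ereal (inverse p) / (2 * \<alpha>)))
              * enn_powr (Lp_norm p (frac_heat \<alpha> s f)) r \<partial>lborel)
          \<le> ennreal (C * T powr (1 - real CARD('n) / (2 * \<alpha>))) * enn_powr (Lp_norm (ereal r) f) r)))
    \<and>
    (\<forall>p::ereal. 2 < p \<longrightarrow> real CARD('n) = 2 * \<alpha> \<longrightarrow>
      (\<exists>C::real. C > 0 \<and>
        (\<forall>f :: real^'n \<Rightarrow> complex. in_Lp 2 f \<longrightarrow>
          (\<integral>\<^sup>+ s \<in> {0<..}.
              ennreal (s powr (- 2 * real_of_ereal (inverse p)))
              * (Lp_norm p (frac_heat \<alpha> s f))\<^sup>2 \<partial>lborel)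
          \<le> ennreal C * (Lp_norm 2 f)\<^sup>2)))"
  using subcritical_estimate[where 'n='n] critical_estimate[where 'n='n] by blast

end
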